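(* Let $K_1$ and $K_2$ be knots with different Alexander polynomials, $\mathrm{Alex}_{K_1}(m)\neq \mathrm{Alex}_{K_2}(m)$. Assume furthermore that their colouring matrices are triangularizable. Then there is a linear Alexander quandle that distinguishes them: there exist coprime integers $n\ge1$ and $m$ such that, for $Q=\mathbb{Z}_n[T,T^{-1}]/(T-m)$, $C_Q(K_1)\neq C_Q(K_2)$.
   Context: **Linear finite Alexander quandle.** For coprime integers $n\ge 1$ and $m$, the quandle $Q=\mathbb{Z}_n[T,T^{-1}]/(T-m)$ is identified with $\mathbb{Z}_n$, with operations $a\ast b=ma+(1-m)b$ and $a\ast' b=m^{-1}a+(1-m^{-1})b$ modulo $n$. **Colourings.** Let $D$ be an oriented diagram of a knot $K$ with $N\ge1$ crossings, hence $N$ arcs. A colouring of $D$ by $Q$ assigns $X_k\in Q$ to each arc $k$ so that at each crossing with incoming under-arc $i$, outgoing under-arc $i'$ and over-arc $j$: $X_{i'}=X_i\ast X_j$ if the crossing is positive (right-handed), $X_{i'}=X_i\ast' X_j$ if it is negative (left-handed). $C_Q(K)$ is the number of colourings; it does not depend on the diagram of $K$. **Colouring matrix.** The $N\times N$ matrix over $\mathbb{Z}[m,m^{-1}]$ ($m$ regarded as an indeterminate), one row per crossing, encoding $mX_i+(1-m)X_j-X_{i'}=0$ (positive crossing) or $m^{-1}X_i+(1-m^{-1})X_j-X_{i'}=0$ (negative crossing); if some of $i,i',j$ coincide the corresponding entries are added. The entries in each row add up to zero. The colourings by $Q$ are the solutions in $\mathbb{Z}_n$ of $AX=0$ after evaluating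 at the integer $m$ modulo $n$. **Equivalent matrices; triangularizable.** $B$ is equivalent to a colouring matrix $A$ if it is obtained from $A$ by finitely many operations of the following kinds: (a) multiplying a row by $m$, $m^{-1}$ or $-1$; (b) replacing a row by its sum with another row; (c) swapping two rows; (d) swapping two columns. $A$ is triangularizable if some (upper) triangular matrix is equivalent to $A$. **Alexander polynomial.** $\mathrm{Alex}_K$ is the determinant of the matrix obtained from a colouring matrix of $K$ by deleting the last row and column; it is defined up to multiplication by $\pm m^k$ and normalized to have no negative powers of $m$ and a positive constant term. Two Alexander polynomials are different if their normalized forms are different. *)

theory Defs
  imports
    "HOL-Library.FuncSet"
    "HOL-Library.Poly_Mapping"
    "HOL-Combinatorics.Orbits"
    "HOL-Number_Theory.Modular_Inverse"
    "Jordan_Normal_Form.Determinant"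
    "Jordan_Normal_Form.Column_Operations"
begin

section \<open>Oriented knot diagrams\<close>

text \<open>
  An oriented knot diagram with at least one crossing is given by its signed Gauss code:
  the cyclic sequence of passages through crossings met when traversing the knot once in
  the direction of its orientation, together with the sign of every crossing.  A signed
  Gauss code determines a closed oriented surface carrying the diagram, and it is the code
  of a diagram on the sphere (equivalently, in the plane) iff this surface has Euler
  characteristic 2.
\<close>

datatype level = Over | Under

record gauss_code =
  passages :: "(nat \<times> level) list"
  positive :: "nat \<Rightarrow> bool"

definition crossings :: "gauss_code \<Rightarrow> nat set" where
  "crossings D = fst ` set (passages D)"

definition well_formed :: "gauss_code \<Rightarrow> bool" where
  "well_formed D \<longleftrightarrow>
     passages D \<noteq> [] \<and> distinct (passages D) \<and>
     set (passages D) = crossings D \<times> {Over, Under}"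

definition pos :: "gauss_code \<Rightarrow> nat \<times> level \<Rightarrow> nat" where
  "pos D p = (THE i. i < length (passages D) \<and> passages D ! i = p)"

text \<open>
  The edge with number \<open>i\<close> is the part of the diagram from the \<open>i\<close>-th passage
  to the next one in the cyclic order, so there are as many edges as passages.
\<close>

definition edges :: "gauss_code \<Rightarrow> nat set" where
  "edges D = {..<length (passages D)}"

definition next_pos :: "gauss_code \<Rightarrow> nat \<Rightarrow> nat" where
  "next_pos D i = (i + 1) mod length (passages D)"

definition prev_pos :: "gauss_code \<Rightarrow> nat \<Rightarrow> nat" where
  "prev_pos D i = (i + length (passages D) - 1) mod length (passages D)"

fun other_level :: "level \<Rightarrow> level" where
  "other_level Over = Under"
| "other_level Under = Over"

definition partner :: "gauss_code \<Rightarrow> nat \<Rightarrow> nat" where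
  "partner D i = (case passages D ! i of (c, l) \<Rightarrow> pos D (c, other_level l))"

text \<open>
  At a positive (right-handed) crossing the under-strand crosses the over-strand from its
  right to its left; at a negative crossing it goes from left to right.  Hence the following
  predicate says that at the \<open>i\<close>-th passage the other strand of the crossing comes from
  the right of the strand being followed and leaves to its left.
\<close>

definition other_goes_left :: "gauss_code \<Rightarrow> nat \<Rightarrow> bool" where
  "other_goes_left D i \<longleftrightarrow>
     (case passages D ! i of (c, l) \<Rightarrow> (l = Over \<longleftrightarrow> positive D c))"

text \<open>
  A dart \<open>(e, True)\<close> or \<open>(e, False)\<close> is the edge \<open>e\<close> traversed along or against the
  orientation.  Walking along a dart and turning left at the crossing it leads to gives the
  next dart on the boundary of the region on the left.  The edge leaving position \<open>j\<close>
  forwards is \<open>j\<close>, and the one leaving it backwards is \<open>prev_pos D j\<close>.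
\<close>

fun turn_left :: "gauss_code \<Rightarrow> nat \<times> bool \<Rightarrow> nat \<times> bool" where
  "turn_left D (e, True) =
     (let i = next_pos D e; j = partner D i
      in if other_goes_left D i then (j, True) else (prev_pos D j, False))"
| "turn_left D (e, False) =
     (let j = partner D e
      in if other_goes_left D e then (prev_pos D j, False) else (j, True))"

definition regions :: "gauss_code \<Rightarrow> (nat \<times> bool) set set" where
  "regions D = Orbits.orbit (turn_left D) ` (edges D \<times> UNIV)"

definition knot_diagram :: "gauss_code \<Rightarrow> bool" where
  "knot_diagram D \<longleftrightarrow>
     well_formed D \<and>
     int (card (crossings D)) - int (card (edges D)) + int (card (regions D)) = 2"

text \<open>
  Arcs run from one under-passage to the next: two consecutive edges belong to the same arc
  iff the passage between them is an over-passage.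
\<close>

definition joined :: "gauss_code \<Rightarrow> (nat \<times> nat) set" where
  "joined D = {(e, next_pos D e) | e. e \<in> edges D \<and> snd (passages D ! next_pos D e) = Over}"

definition arc :: "gauss_code \<Rightarrow> nat \<Rightarrow> nat set" where
  "arc D e = (joined D \<union> (joined D)\<inverse>)\<^sup>* `` {e}"

definition arcs :: "gauss_code \<Rightarrow> nat set set" where
  "arcs D = arc D ` edges D"

definition in_arc :: "gauss_code \<Rightarrow> nat \<Rightarrow> nat set" where
  "in_arc D c = arc D (prev_pos D (pos D (c, Under)))"

definition out_arc :: "gauss_code \<Rightarrow> nat \<Rightarrow> nat set" where
  "out_arc D c = arc D (pos D (c, Under))"

definition over_arc :: "gauss_code \<Rightarrow> nat \<Rightarrow> nat set" where
  "over_arc D c = arc D (pos D (c, Over))"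


section \<open>Colourings by linear Alexander quandles\<close>

text \<open>
  For coprime \<open>n \<ge> 1\<close> and \<open>m\<close>, the quandle \<open>\<int>\<^sub>n[T,T\<^sup>-\<^sup>1]/(T - m)\<close> is represented on
  the residues \<open>{0..<n}\<close>.
\<close>

definition quandle_op :: "int \<Rightarrow> int \<Rightarrow> int \<Rightarrow> int \<Rightarrow> int" where
  "quandle_op n m a b = (m * a + (1 - m) * b) mod n"

definition quandle_op' :: "int \<Rightarrow> int \<Rightarrow> int \<Rightarrow> int \<Rightarrow> int" where
  "quandle_op' n m a b =
     (modular_inverse n m * a + (1 - modular_inverse n m) * b) mod n"

definition colourings :: "int \<Rightarrow> int \<Rightarrow> gauss_code \<Rightarrow> (nat set \<Rightarrow> int) set" where
  "colourings n m D =
     {X \<in> arcs D \<rightarrow>\<^sub>E {0..<n}. \<forall>c \<in> crossings D.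
        X (out_arc D c) =
          (if positive D c then quandle_op n m (X (in_arc D c)) (X (over_arc D c))
           else quandle_op' n m (X (in_arc D c)) (X (over_arc D c)))}"

definition num_colourings :: "int \<Rightarrow> int \<Rightarrow> gauss_code \<Rightarrow> nat" where
  "num_colourings n m D = card (colourings n m D)"


section \<open>Colouring matrices and the Alexander polynomial\<close>

text \<open>
  The ring \<open>\<int>[m, m\<^sup>-\<^sup>1]\<close> is the group ring of \<open>\<int>\<close> over \<open>\<int>\<close>, i.e. the finitely supported
  functions from exponents to coefficients with the convolution product.
\<close>

type_synonym laurent = "int \<Rightarrow>\<^sub>0 int"

definition mpow :: "int \<Rightarrow> laurent" where
  "mpow k = Poly_Mapping.single k 1"

definition colouring_entry :: "gauss_code \<Rightarrow> nat \<Rightarrow> nat set \<Rightarrow> laurent" where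
  "colouring_entry D c a =
     (let t = (if positive D c then mpow 1 else mpow (- 1))
      in (if a = in_arc D c then t else 0)
       + (if a = over_arc D c then 1 - t else 0)
       + (if a = out_arc D c then - 1 else 0))"

text \<open>The crossings and the arcs may be enumerated in any order.\<close>

definition colouring_matrix :: "gauss_code \<Rightarrow> laurent mat \<Rightarrow> bool" where
  "colouring_matrix D A \<longleftrightarrow>
     (let N = card (crossings D)
      in \<exists>row col. bij_betw row {..<N} (crossings D) \<and> bij_betw col {..<N} (arcs D) \<and>
           A = mat N N (\<lambda>(i, k). colouring_entry D (row i) (col k)))"

inductive matrix_step :: "laurent mat \<Rightarrow> laurent mat \<Rightarrow> bool" where
  "k < dim_row A \<Longrightarrow> u \<in> {mpow 1, mpow (- 1), - 1} \<Longrightarrow> matrix_step A (multrow k u A)"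
| "k < dim_row A \<Longrightarrow> l < dim_row A \<Longrightarrow> k \<noteq> l \<Longrightarrow> matrix_step A (addrow 1 k l A)"
| "k < dim_row A \<Longrightarrow> l < dim_row A \<Longrightarrow> matrix_step A (swaprows k l A)"
| "k < dim_col A \<Longrightarrow> l < dim_col A \<Longrightarrow> matrix_step A (swapcols k l A)"

definition triangularizable :: "laurent mat \<Rightarrow> bool" where
  "triangularizable A \<longleftrightarrow> (\<exists>B. matrix_step\<^sup>*\<^sup>* A B \<and> upper_triangular B)"

text \<open>
  \<open>p\<close> is the normalized determinant of a colouring matrix with its last row and column
  deleted: no negative powers of \<open>m\<close> and a positive constant term.
\<close>

definition alexander_polynomial :: "gauss_code \<Rightarrow> laurent \<Rightarrow> bool" where
  "alexander_polynomial D p \<longleftrightarrow>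
     (\<exists>A s k. colouring_matrix D A \<and> s \<in> {1, - 1} \<and>
        p = s * mpow k * det (mat_delete A (dim_row A - 1) (dim_col A - 1))) \<and>
     (\<forall>j < 0. Poly_Mapping.lookup p j = 0) \<and> Poly_Mapping.lookup p 0 > 0"

end

(*
  A colouring matrix with denominators cleared, evaluated at an integer m, has zero row sums, and
  for a planar diagram its rows satisfy a relation modulo n whose coefficients are powers of m.
  Hence the number of colourings is n times the number of zeros modulo n of the matrix with the
  last row and column deleted, whose determinant is the Alexander polynomial at m up to sign and
  powers of m.  A square matrix has gcd(det, n) zeros modulo n if det divides n up to a factor
  coprime to n.  So with n = |p1(m) p2(m)| the numbers of colourings are n |p1(m)| and n |p2(m)|,
  and these differ for almost all m; taking m = 1 modulo p1(0) p2(0) makes m and n coprime.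

  The relation between the rows comes from an Alexander numbering of the regions.  Its existence
  is proved by counting functions from the regions to the integers modulo q, using Euler
  characteristic 2.
*)
theory Submission
  imports Defs "HOL-Number_Theory.Residues"
begin

section \<open>Zeros of an integer matrix modulo \<open>n\<close>\<close>

text \<open>In general the number of zeros of a square matrix modulo n depends on all its elementary
  divisors, not only on their product, the determinant. The choice of n removes this obstacle: when
  the determinant divides n, so does every elementary divisor, and each contributes its full
  absolute value to the count. Here divisibility holds only up to a factor u, a power of m that
  comes from clearing denominators and from normalizing the Alexander polynomial; being a unit
  modulo n, it does not affect the count.

  A row may be deleted only if its congruence follows from the others, so the relation between the
  rows must have a unit as coefficient there; powers of m are units modulo n. Since the relation is
  needed only modulo n, exponents matter only modulo the totient of n. A numbering with values in a
  finite ring is enough, and its existence reduces to counting: an injective map between finite sets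
  of equal size is onto. Planarity thus enters only through the number of regions.\<close>

definition ker_mod :: "int \<Rightarrow> int mat \<Rightarrow> (nat \<Rightarrow> int) set" where
  "ker_mod n M = {x \<in> {..<dim_col M} \<rightarrow>\<^sub>E {0..<n}.
     \<forall>i<dim_row M. n dvd (\<Sum>k<dim_col M. M $$ (i, k) * x k)}"

section \<open>Integer row operations\<close>

lemma ker_mod_addrow:
  assumes "k < dim_row M" "l < dim_row M" "k \<noteq> l"
  shows "ker_mod n (addrow a k l M) = ker_mod n M"
proof -
  have *: "(\<Sum>j<dim_col M. addrow a k l M $$ (i, j) * x j) =
      (if i = k then a * (\<Sum>j<dim_col M. M $$ (l, j) * x j) else 0) + (\<Sum>j<dim_col M. M $$ (i, j) * x j)"
    if "i < dim_row M" for i x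
    using that by (auto simp: sum_distrib_left sum.distrib[symmetric] algebra_simps intro!: sum.cong)
  have "(\<forall>i<dim_row M. n dvd (\<Sum>j<dim_col M. addrow a k l M $$ (i, j) * x j)) \<longleftrightarrow>
      (\<forall>i<dim_row M. n dvd (\<Sum>j<dim_col M. M $$ (i, j) * x j))" (is "?L \<longleftrightarrow> ?R") for x
  proof
    assume ?L
    have l: "n dvd (\<Sum>j<dim_col M. M $$ (l, j) * x j)"
      using \<open>?L\<close>[rule_format, OF assms(2)] assms(2,3) unfolding *[OF assms(2)] by simp
    show ?R
    proof (intro allI impI)
      fix i assume i: "i < dim_row M"
      show "n dvd (\<Sum>j<dim_col M. M $$ (i, j) * x j)"
        using \<open>?L\<close>[rule_format, OF i] l unfolding *[OF i]
        by (cases "i = k") (simp_all add: dvd_add_right_iff)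
    qed
  next
    assume ?R
    with assms(2) show ?L by (auto simp del: index_mat_addrow(1) simp: *)
  qed
  then show ?thesis by (simp add: ker_mod_def del: index_mat_addrow(1))
qed

lemma ker_mod_swaprows:
  assumes "k < dim_row M" "l < dim_row M"
  shows "ker_mod n (swaprows k l M) = ker_mod n M"
proof -
  have *: "(\<Sum>j<dim_col M. swaprows k l M $$ (i, j) * x j) =
      (\<Sum>j<dim_col M. M $$ (Transposition.transpose k l i, j) * x j)" if "i < dim_row M" for i x
    using that by (auto simp: Transposition.transpose_def)
  have "(\<forall>i<dim_row M. P (Transposition.transpose k l i)) \<longleftrightarrow> (\<forall>i<dim_row M. P i)" for P
    using assms by (metis transpose_apply_first transpose_apply_other transpose_apply_second)
  from this[of "\<lambda>i. n dvd (\<Sum>j<dim_col M. M $$ (i, j) * _ j)"] show ?thesis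
    by (simp add: ker_mod_def * del: index_mat_swaprows(1))
qed

text \<open>The Euclidean algorithm on the entries of the first column, with the sum of their
  absolute values as measure. Only row operations occur, so the unknowns keep their meaning and the
  zero set itself is preserved; swaps may change the sign of the determinant.\<close>

lemma first_column_reduction:
  fixes M :: "int mat"
  assumes "M \<in> carrier_mat (Suc N) (Suc N)"
  shows "\<exists>M' \<in> carrier_mat (Suc N) (Suc N). (\<forall>i\<in>{1..N}. M' $$ (i, 0) = 0) \<and>
           \<bar>det M'\<bar> = \<bar>det M\<bar> \<and> ker_mod n M' = ker_mod n M"
  using assms
proof (induction "\<Sum>i<Suc N. nat \<bar>M $$ (i, 0)\<bar>" arbitrary: M rule: less_induct)
  case less
  show ?case
  proof (cases "\<exists>i j. i < Suc N \<and> j < Suc N \<and> i \<noteq> j \<and> M $$ (i, 0) \<noteq> 0 \<and> M $$ (j, 0) \<noteq> 0")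
    case True
    then obtain i j where ij: "i < Suc N" "j < Suc N" "i \<noteq> j" "M $$ (j, 0) \<noteq> 0"
        "\<bar>M $$ (j, 0)\<bar> \<le> \<bar>M $$ (i, 0)\<bar>"
      by (metis linorder_le_cases)
    \<comment> \<open>With this sign, adding \<open>c\<close> times row \<open>j\<close> moves the
      entry of row \<open>i\<close> towards zero by the absolute value of that of row
      \<open>j\<close>, which is nonzero and not larger.\<close>
    define c where "c = - sgn (M $$ (i, 0)) * sgn (M $$ (j, 0))"
    let ?M = "addrow c i j M"
    have smaller: "nat \<bar>?M $$ (i, 0)\<bar> < nat \<bar>M $$ (i, 0)\<bar>"
      using ij less.prems by (auto simp: c_def sgn_if)
    have "(\<Sum>k<Suc N. nat \<bar>?M $$ (k, 0)\<bar>) < (\<Sum>k<Suc N. nat \<bar>M $$ (k, 0)\<bar>)"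
    proof (rule sum_strict_mono_ex1)
      show "\<forall>k\<in>{..<Suc N}. nat \<bar>?M $$ (k, 0)\<bar> \<le> nat \<bar>M $$ (k, 0)\<bar>"
      proof
        fix k assume "k \<in> {..<Suc N}"
        then show "nat \<bar>?M $$ (k, 0)\<bar> \<le> nat \<bar>M $$ (k, 0)\<bar>"
          using smaller less.prems by (cases "k = i") auto
      qed
    qed (use smaller ij in auto)
    from less.hyps[OF this] obtain M' where "M' \<in> carrier_mat (Suc N) (Suc N)"
      "\<forall>i\<in>{1..N}. M' $$ (i, 0) = 0" "\<bar>det M'\<bar> = \<bar>det ?M\<bar>" "ker_mod n M' = ker_mod n ?M"
      using less.prems by auto
    moreover have "det ?M = det M"
      using det_addrow[OF ij(2,3) less.prems] .
    moreover have "ker_mod n ?M = ker_mod n M"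
      using ker_mod_addrow ij less.prems by auto
    ultimately show ?thesis by auto
  next
    case False
    then obtain k where k: "k < Suc N" "\<And>i. i < Suc N \<Longrightarrow> i \<noteq> k \<Longrightarrow> M $$ (i, 0) = 0"
      by (metis zero_less_Suc)
    let ?M = "swaprows k 0 M"
    have "\<bar>det ?M\<bar> = \<bar>det M\<bar>"
    proof (cases "k = 0")
      case True
      then have "?M = M" using less.prems by (intro eq_matI) auto
      then show ?thesis by simp
    next
      case False
      then show ?thesis using det_swaprows[OF k(1) _ False less.prems] by simp
    qed
    moreover have "ker_mod n ?M = ker_mod n M"
      using k less.prems by (intro ker_mod_swaprows) auto
    moreover have "?M $$ (i, 0) = 0" if "i \<in> {1..N}" for i
      using that k less.prems by auto
    ultimately show ?thesis
      using less.prems by (intro bexI[of _ ?M]) auto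
  qed
qed

section \<open>Counting zeros through the determinant\<close>

lemma det_first_column_zero:
  fixes M :: "'a :: comm_ring_1 mat"
  assumes "M \<in> carrier_mat (Suc N) (Suc N)" "\<And>i. i \<in> {1..N} \<Longrightarrow> M $$ (i, 0) = 0"
  shows "det M = M $$ (0, 0) * det (mat_delete M 0 0)"
proof -
  have "det M = (\<Sum>i<Suc N. M $$ (i, 0) * cofactor M i 0)"
    using laplace_expansion_column[OF assms(1), of 0] by simp
  also have "\<dots> = M $$ (0, 0) * cofactor M 0 0"
    by (subst sum.lessThan_Suc_shift) (auto intro!: sum.neutral simp: assms(2))
  finally show ?thesis by (simp add: cofactor_def)
qed

text \<open>Dividing by g = gcd a n leaves a congruence modulo n div g with invertible coefficient;
  its single solution class splits into g classes modulo n.\<close>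

lemma card_linear_congruence:
  fixes a b n :: int
  assumes "n > 0" "gcd a n dvd b"
  shows "card {x \<in> {0..<n}. n dvd a * x + b} = nat (gcd a n)"
proof -
  define g where "g = gcd a n"
  have g: "g > 0" using assms by (simp add: g_def)
  define a' n' where "a' = a div g" and "n' = n div g"
  then have a': "a = g * a'" and n': "n = g * n'" and cop: "coprime a' n'"
    using assms div_gcd_coprime[of a n] by (simp_all add: g_def)
  obtain b' where b': "b = g * b'" using assms by (auto simp: g_def elim: dvdE)
  have n'0: "n' > 0" using n' assms g zero_less_mult_pos by blast
  obtain v where v: "[a' * v = 1] (mod n')" using cop cong_solve_coprime_int by blast
  define x0 where "x0 = (- b' * v) mod n'"
  have iff: "n dvd a * x + b \<longleftrightarrow> x mod n' = x0" for x
  proof -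
    have "a * x + b = g * (a' * x + b')" by (simp add: a' b' algebra_simps)
    then have "n dvd a * x + b \<longleftrightarrow> n' dvd a' * x + b'"
      using g by (simp add: n')
    also have "\<dots> \<longleftrightarrow> [a' * x = - b'] (mod n')"
      by (simp add: cong_iff_dvd_diff)
    also have "\<dots> \<longleftrightarrow> [x = - b' * v] (mod n')"
    proof
      assume "[a' * x = - b'] (mod n')"
      then have "[v * (a' * x) = v * (- b')] (mod n')" by (rule cong_scalar_left)
      moreover have "[x * (a' * v) = x * 1] (mod n')" using v by (rule cong_scalar_left)
      ultimately show "[x = - b' * v] (mod n')"
        by (simp add: ac_simps) (metis cong_sym cong_trans mult.left_commute)
    next
      assume "[x = - b' * v] (mod n')"
      then have "[a' * x = a' * (- b' * v)] (mod n')" by (rule cong_scalar_left)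
      moreover have "[- b' * (a' * v) = - b' * 1] (mod n')" using v by (rule cong_scalar_left)
      ultimately show "[a' * x = - b'] (mod n')"
        by (simp add: ac_simps) (metis cong_trans mult.left_commute)
    qed
    also have "\<dots> \<longleftrightarrow> x mod n' = x0" by (simp add: cong_def x0_def)
    finally show ?thesis .
  qed
  have x0: "0 \<le> x0" "x0 < n'" using n'0 by (auto simp: x0_def)
  have "{x \<in> {0..<n}. n dvd a * x + b} = (\<lambda>t. x0 + t * n') ` {0..<g}"
  proof (intro equalityI subsetI)
    fix x assume "x \<in> {x \<in> {0..<n}. n dvd a * x + b}"
    then have x: "0 \<le> x" "x < g * n'" "x mod n' = x0"
      using iff[of x] unfolding n'[symmetric] by auto
    then have "x = x0 + (x div n') * n'" using mod_div_mult_eq[of x n'] by simp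
    moreover from this have "(x div n') * n' < g * n'" using x x0 by linarith
    then have "x div n' < g" using n'0 by (simp add: mult_less_cancel_right_pos)
    ultimately show "x \<in> (\<lambda>t. x0 + t * n') ` {0..<g}"
      using x n'0 by (intro image_eqI[of _ _ "x div n'"]) (auto simp: pos_imp_zdiv_nonneg_iff)
  next
    fix x assume "x \<in> (\<lambda>t. x0 + t * n') ` {0..<g}"
    then obtain t where t: "0 \<le> t" "t < g" "x = x0 + t * n'" by auto
    have "x0 + t * n' < n' + t * n'" using x0 by simp
    also have "\<dots> = (t + 1) * n'" by (simp add: algebra_simps)
    also have "\<dots> \<le> g * n'" using t n'0 by (intro mult_right_mono) auto
    finally show "x \<in> {x \<in> {0..<n}. n dvd a * x + b}"
      using t x0 n'0 by (simp add: iff) (simp add: n')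
  qed
  moreover have "inj_on (\<lambda>t. x0 + t * n') {0..<g}"
    using n'0 by (auto simp: inj_on_def)
  ultimately show ?thesis by (simp add: card_image g_def)
qed

text \<open>Multiplying the system by the adjugate turns every row into
  \<open>det M * x k\<close>.\<close>

lemma ker_mod_det_dvd:
  assumes M: "M \<in> carrier_mat N N" and x: "x \<in> ker_mod n M" and k: "k < N"
  shows "n dvd det M * x k"
proof -
  let ?x = "vec N x"
  have adj: "adj_mat M \<in> carrier_mat N N" "adj_mat M * M = det M \<cdot>\<^sub>m 1\<^sub>m N"
    using adj_mat[OF M] by auto
  have "adj_mat M *\<^sub>v (M *\<^sub>v ?x) = (det M \<cdot>\<^sub>m 1\<^sub>m N) *\<^sub>v ?x"
    using assoc_mult_mat_vec[OF adj(1) M, of ?x] adj(2) by simp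
  then have "(adj_mat M *\<^sub>v (M *\<^sub>v ?x)) $ k = ((det M \<cdot>\<^sub>m 1\<^sub>m N) *\<^sub>v ?x) $ k" by simp
  moreover have "((det M \<cdot>\<^sub>m 1\<^sub>m N) *\<^sub>v ?x) $ k = det M * x k"
    using k by (simp add: scalar_prod_def if_distrib[of "\<lambda>z. _ * z"] if_distrib[of "\<lambda>z. z * _"] cong: if_cong)
  moreover have "(adj_mat M *\<^sub>v (M *\<^sub>v ?x)) $ k = (\<Sum>i<N. adj_mat M $$ (k, i) * (\<Sum>l<N. M $$ (i, l) * x l))"
    using k adj(1) M by (simp add: scalar_prod_def atLeast0LessThan)
  moreover have "n dvd (\<Sum>i<N. adj_mat M $$ (k, i) * (\<Sum>l<N. M $$ (i, l) * x l))"
    by (rule dvd_sum, rule dvd_mult) (use x M in \<open>auto simp: ker_mod_def\<close>)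
  ultimately show ?thesis by simp
qed

lemma finite_ker_mod [simp]: "finite (ker_mod n M)"
  unfolding ker_mod_def by (rule finite_subset[of _ "{..<dim_col M} \<rightarrow>\<^sub>E {0..<n}"]) (auto intro: finite_PiE)

text \<open>Bezout gives divisibility from left to right. The converse fails in general (a = b = n =
  2); here the product of the gcds divides \<open>u * n\<close> and is coprime to \<open>u\<close>,
  hence divides n.\<close>

lemma gcd_mult_eq:
  fixes a b n u :: int
  assumes "a * b dvd u * n" "coprime u n"
  shows "gcd (a * b) n = gcd a n * gcd b n"
proof (rule zdvd_antisym_nonneg)
  obtain r s where r: "r * a + s * n = gcd a n" using bezout_int by blast
  obtain r' s' where r': "r' * b + s' * n = gcd b n" using bezout_int by blast
  have "gcd a n * gcd b n = (r * r') * (a * b) + (r * a * s' + r' * b * s + s * s' * n) * n"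
    unfolding r[symmetric] r'[symmetric] by (simp add: algebra_simps)
  then show "gcd (a * b) n dvd gcd a n * gcd b n"
    by (metis dvd_add dvd_mult gcd_dvd1 gcd_dvd2)
  have "gcd a n * gcd b n dvd u * n"
    using assms(1) by (meson dvd_trans gcd_dvd1 mult_dvd_mono)
  moreover have "coprime (gcd a n * gcd b n) u"
    using assms(2) by (metis coprime_commute coprime_divisors coprime_mult_left_iff dvd_refl gcd_dvd2)
  ultimately have "gcd a n * gcd b n dvd n"
    by (simp add: coprime_dvd_mult_right_iff)
  then show "gcd a n * gcd b n dvd gcd (a * b) n"
    by (simp add: mult_dvd_mono)
qed auto

lemma PiE_lessThan_Suc:
  "x \<in> {..<Suc N} \<rightarrow>\<^sub>E A \<longleftrightarrow> x 0 \<in> A \<and> (\<lambda>k. x (Suc k)) \<in> {..<N} \<rightarrow>\<^sub>E A"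
proof -
  have all: "(\<forall>i. Q i) \<longleftrightarrow> Q 0 \<and> (\<forall>i. Q (Suc i))" for Q :: "nat \<Rightarrow> bool"
    by (metis not0_implies_Suc)
  have "x \<in> {..<Suc N} \<rightarrow>\<^sub>E A \<longleftrightarrow> (\<forall>i. if i < Suc N then x i \<in> A else x i = undefined)"
    by (auto simp: PiE_iff extensional_def)
  also have "\<dots> \<longleftrightarrow> x 0 \<in> A \<and> (\<forall>i. if i < N then x (Suc i) \<in> A else x (Suc i) = undefined)"
    by (subst all) simp
  also have "\<dots> \<longleftrightarrow> x 0 \<in> A \<and> (\<lambda>k. x (Suc k)) \<in> {..<N} \<rightarrow>\<^sub>E A"
    by (auto simp: PiE_iff extensional_def)
  finally show ?thesis .
qed

text \<open>The zeros of M are fibred over the zeros y of the block: the fibre over y consists of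
  the solutions of the first row for the first unknown. By \<open>solv\<close> no fibre is empty, so
  all have the same size.\<close>

lemma card_ker_mod_block:
  fixes M :: "int mat"
  assumes M: "M \<in> carrier_mat (Suc N) (Suc N)" and col: "\<And>i. i \<in> {1..N} \<Longrightarrow> M $$ (i, 0) = 0"
    and n: "n > 0"
    and solv: "\<And>y. y \<in> ker_mod n (mat_delete M 0 0) \<Longrightarrow>
      gcd (M $$ (0, 0)) n dvd (\<Sum>k<N. M $$ (0, Suc k) * y k)"
  shows "card (ker_mod n M) = nat (gcd (M $$ (0, 0)) n) * card (ker_mod n (mat_delete M 0 0))"
proof -
  let ?M' = "mat_delete M 0 0" and ?a = "M $$ (0, 0)"
  define b where "b y = (\<Sum>k<N. M $$ (0, Suc k) * y k)" for y :: "nat \<Rightarrow> int"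
  define S where "S y = {t \<in> {0..<n}. n dvd ?a * t + b y}" for y
  define F where "F = (\<lambda>(y :: nat \<Rightarrow> int, t :: int). \<lambda>k. case k of 0 \<Rightarrow> t | Suc k \<Rightarrow> y k)"
  have dims: "dim_row ?M' = N" "dim_col ?M' = N" using M by auto
  have entry: "?M' $$ (i, k) = M $$ (Suc i, Suc k)" if "i < N" "k < N" for i k
    using M that by (simp add: mat_delete_def)
  have row0: "(\<Sum>k<Suc N. M $$ (0, k) * x k) = ?a * x 0 + b (\<lambda>k. x (Suc k))" for x
    by (subst sum.lessThan_Suc_shift) (simp add: b_def)
  have rowS: "(\<Sum>k<Suc N. M $$ (Suc i, k) * x k) = (\<Sum>k<N. ?M' $$ (i, k) * x (Suc k))" if "i < N" for x i
    using that col[of "Suc i"] by (subst sum.lessThan_Suc_shift) (simp add: entry)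
  have all_Suc: "(\<forall>i<Suc N. P i) \<longleftrightarrow> P 0 \<and> (\<forall>i<N. P (Suc i))" for P
    using less_Suc_eq_0_disj by auto
  have mem: "x \<in> ker_mod n M \<longleftrightarrow> (x 0 \<in> S (\<lambda>k. x (Suc k)) \<and> (\<lambda>k. x (Suc k)) \<in> ker_mod n ?M')" for x
  proof -
    have "x \<in> ker_mod n M \<longleftrightarrow> x \<in> {..<Suc N} \<rightarrow>\<^sub>E {0..<n} \<and>
        (\<forall>i<Suc N. n dvd (\<Sum>k<Suc N. M $$ (i, k) * x k))"
      using M unfolding ker_mod_def by (auto simp del: sum.lessThan_Suc)
    also have "\<dots> \<longleftrightarrow> (x 0 \<in> {0..<n} \<and> (\<lambda>k. x (Suc k)) \<in> {..<N} \<rightarrow>\<^sub>E {0..<n}) \<and>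
        n dvd ?a * x 0 + b (\<lambda>k. x (Suc k)) \<and> (\<forall>i<N. n dvd (\<Sum>k<N. ?M' $$ (i, k) * x (Suc k)))"
      unfolding PiE_lessThan_Suc all_Suc row0 using rowS by (simp del: sum.lessThan_Suc)
    also have "\<dots> \<longleftrightarrow> x 0 \<in> S (\<lambda>k. x (Suc k)) \<and> (\<lambda>k. x (Suc k)) \<in> ker_mod n ?M'"
      unfolding ker_mod_def S_def dims mem_Collect_eq by blast
    finally show ?thesis .
  qed
  have "bij_betw F (SIGMA y:ker_mod n ?M'. S y) (ker_mod n M)"
    by (rule bij_betw_byWitness[where f' = "\<lambda>x. (\<lambda>k. x (Suc k), x 0)"])
      (auto simp: F_def mem fun_eq_iff split: nat.split)
  then have "card (ker_mod n M) = card (SIGMA y:ker_mod n ?M'. S y)"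
    by (simp add: bij_betw_same_card)
  also have "\<dots> = (\<Sum>y\<in>ker_mod n ?M'. card (S y))"
    by (intro card_SigmaI ballI finite_ker_mod, rule finite_subset[of _ "{0..<n}"]) (auto simp: S_def)
  also have "\<dots> = (\<Sum>y\<in>ker_mod n ?M'. nat (gcd ?a n))"
    using solv card_linear_congruence[OF n, of ?a] by (intro sum.cong refl) (simp add: S_def b_def)
  finally show ?thesis by simp
qed

text \<open>
  After clearing the first column below its entry \<open>a\<close>, every zero \<open>y\<close> of the remaining block has
  all entries divisible by \<open>gcd a n\<close>, so the congruence of the first row can be solved for its
  first unknown, with \<open>gcd a n\<close> solutions.
\<close>

lemma card_ker_mod:
  fixes M :: "int mat"
  assumes "M \<in> carrier_mat N N" "n > 0" "coprime u n" "u \<noteq> 0" "det M dvd u * n"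
  shows "card (ker_mod n M) = nat (gcd (det M) n)"
  using assms(1,5)
proof (induction N arbitrary: M)
  case 0
  then have "ker_mod n M = {\<lambda>_. undefined}" by (auto simp: ker_mod_def)
  with 0 show ?case by simp
next
  case (Suc N)
  obtain M' where M': "M' \<in> carrier_mat (Suc N) (Suc N)" "\<And>i. i \<in> {1..N} \<Longrightarrow> M' $$ (i, 0) = 0"
    "\<bar>det M'\<bar> = \<bar>det M\<bar>" "ker_mod n M' = ker_mod n M"
    using first_column_reduction[OF Suc.prems(1), of n] by blast
  let ?B = "mat_delete M' 0 0" and ?a = "M' $$ (0, 0)"
  have B: "?B \<in> carrier_mat N N" using mat_delete_carrier[OF M'(1)] by simp
  have det: "det M' = ?a * det ?B" using det_first_column_zero M' by blast
  have dvd: "?a * det ?B dvd u * n"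
    using Suc.prems(2) M'(3) det by (metis abs_dvd_iff)
  have nz: "u * n \<noteq> 0" using assms by simp
  \<comment> \<open>From \<open>n dvd det ?B * y k\<close> and \<open>?a * det ?B dvd u * n\<close>
    the nonzero factor \<open>det ?B\<close> cancels; \<open>u\<close> then drops out because it is
    coprime to n.\<close>
  have "gcd ?a n dvd y k" if y: "y \<in> ker_mod n ?B" and k: "k < N" for y k
  proof -
    have "n dvd det ?B * y k" using ker_mod_det_dvd[OF B y k] .
    then have "?a * det ?B dvd u * (det ?B * y k)"
      using dvd by (meson dvd_refl dvd_trans mult_dvd_mono)
    then have "det ?B * ?a dvd det ?B * (u * y k)" by (simp add: ac_simps)
    moreover have "det ?B \<noteq> 0" using dvd nz by auto
    ultimately have "?a dvd u * y k" by simp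
    then have "gcd ?a n dvd u * y k" by (meson dvd_trans gcd_dvd1)
    moreover have "coprime (gcd ?a n) u"
      using assms(3) by (metis coprime_commute coprime_divisors dvd_refl gcd_dvd2)
    ultimately show ?thesis by (simp add: coprime_dvd_mult_right_iff)
  qed
  then have "card (ker_mod n M') = nat (gcd ?a n) * card (ker_mod n ?B)"
    using M' assms by (intro card_ker_mod_block) (auto intro!: dvd_sum dvd_mult)
  also have "card (ker_mod n ?B) = nat (gcd (det ?B) n)"
    using Suc.IH[OF B] dvd by (meson dvd_mult_right)
  also have "nat (gcd ?a n) * nat (gcd (det ?B) n) = nat (gcd (det M') n)"
    using gcd_mult_eq[OF dvd assms(3)] det by (simp add: nat_mult_distrib)
  also have "gcd (det M') n = gcd (det M) n" using M'(3) by (metis gcd_abs1_int)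
  finally show ?case using M'(4) by simp
qed

text \<open>Zero row sums make constant vectors zeros, so the last unknown is free (n choices) and
  subtracting it from the others makes the last column irrelevant. The relation with weights
  \<open>w\<close> makes the last row a consequence of the others, since \<open>w N\<close> can be
  cancelled modulo n.\<close>

lemma card_ker_mod_delete_last:
  fixes M :: "int mat"
  assumes M: "M \<in> carrier_mat (Suc N) (Suc N)" and n: "n > 0"
    and rows: "\<And>i. i < Suc N \<Longrightarrow> (\<Sum>k<Suc N. M $$ (i, k)) = 0"
    and cols: "\<And>k. k < Suc N \<Longrightarrow> n dvd (\<Sum>i<Suc N. w i * M $$ (i, k))"
    and cop: "coprime (w N) n"
  shows "card (ker_mod n M) = nat n * card (ker_mod n (mat_delete M N N))"
proof -
  let ?M' = "mat_delete M N N"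
  define F where "F = (\<lambda>(t :: int, y :: nat \<Rightarrow> int). \<lambda>k. if k < N then (y k + t) mod n else if k = N then t else undefined)"
  define G where "G = (\<lambda>x :: nat \<Rightarrow> int. (x N, \<lambda>k. if k < N then (x k - x N) mod n else undefined))"
  have dims: "dim_row ?M' = N" "dim_col ?M' = N" using M by auto
  have entry: "?M' $$ (i, k) = M $$ (i, k)" if "i < N" "k < N" for i k
    using M that by (simp add: mat_delete_def)
  have row: "[(\<Sum>k<Suc N. M $$ (i, k) * x k) = (\<Sum>k<N. M $$ (i, k) * y k)] (mod n)"
    if i: "i < Suc N" and xy: "\<And>k. k < N \<Longrightarrow> [x k - x N = y k] (mod n)" for i and x y :: "nat \<Rightarrow> int"
  proof -
    have "(\<Sum>k<Suc N. M $$ (i, k) * x k) = (\<Sum>k<Suc N. M $$ (i, k) * (x k - x N)) + (\<Sum>k<Suc N. M $$ (i, k)) * x N"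
      by (simp only: right_diff_distrib sum_subtractf sum_distrib_right diff_add_cancel)
    also have "\<dots> = (\<Sum>k<N. M $$ (i, k) * (x k - x N))" using rows[OF i] by simp
    also have "[\<dots> = (\<Sum>k<N. M $$ (i, k) * y k)] (mod n)"
      using xy by (intro cong_sum cong_scalar_left) auto
    finally show ?thesis .
  qed
  have last: "n dvd (\<Sum>k<Suc N. M $$ (N, k) * x k)"
    if h: "\<And>i. i < N \<Longrightarrow> n dvd (\<Sum>k<Suc N. M $$ (i, k) * x k)" for x
  proof -
    let ?s = "\<lambda>i. \<Sum>k<Suc N. M $$ (i, k) * x k"
    have "(\<Sum>i<Suc N. w i * ?s i) = (\<Sum>k<Suc N. (\<Sum>i<Suc N. w i * M $$ (i, k)) * x k)"
      unfolding sum_distrib_left sum_distrib_right by (subst sum.swap) (simp add: mult.assoc)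
    moreover have "n dvd (\<Sum>k<Suc N. (\<Sum>i<Suc N. w i * M $$ (i, k)) * x k)"
      by (rule dvd_sum, rule dvd_mult2) (use cols in auto)
    ultimately have "n dvd (\<Sum>i<Suc N. w i * ?s i)" by (simp only:)
    then have "n dvd (\<Sum>i<N. w i * ?s i) + w N * ?s N"
      by (simp only: sum.lessThan_Suc[of "\<lambda>i. w i * ?s i"])
    moreover have "n dvd (\<Sum>i<N. w i * ?s i)"
      by (rule dvd_sum, rule dvd_mult) (use h in auto)
    ultimately have "n dvd w N * ?s N" by (simp only: dvd_add_right_iff)
    moreover have "coprime n (w N)" using cop by (simp add: coprime_commute)
    ultimately show ?thesis by (simp only: coprime_dvd_mult_right_iff)
  qed
  have mem: "x \<in> ker_mod n M \<longleftrightarrow> y \<in> ker_mod n ?M'"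
    if x: "x \<in> {..<Suc N} \<rightarrow>\<^sub>E {0..<n}" and y: "y \<in> {..<N} \<rightarrow>\<^sub>E {0..<n}"
      and xy: "\<And>k. k < N \<Longrightarrow> [x k - x N = y k] (mod n)" for x y
  proof -
    have "x \<in> ker_mod n M \<longleftrightarrow> (\<forall>i<Suc N. n dvd (\<Sum>k<Suc N. M $$ (i, k) * x k))"
      using x M unfolding ker_mod_def by (auto simp del: sum.lessThan_Suc)
    also have "\<dots> \<longleftrightarrow> (\<forall>i<N. n dvd (\<Sum>k<Suc N. M $$ (i, k) * x k))"
      using last[of x] less_Suc_eq by blast
    also have "\<dots> \<longleftrightarrow> (\<forall>i<N. n dvd (\<Sum>k<N. M $$ (i, k) * y k))"
    proof -
      have "n dvd (\<Sum>k<Suc N. M $$ (i, k) * x k) \<longleftrightarrow> n dvd (\<Sum>k<N. M $$ (i, k) * y k)" if "i < N" for i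
        using row[of i x y] xy that by (intro cong_dvd_iff) simp
      then show ?thesis by blast
    qed
    also have "\<dots> \<longleftrightarrow> y \<in> ker_mod n ?M'"
      using y unfolding ker_mod_def dims by (simp add: entry)
    finally show ?thesis .
  qed
  have FS: "F (t, y) \<in> {..<Suc N} \<rightarrow>\<^sub>E {0..<n}" if "t \<in> {0..<n}" for t y
    using that n by (auto simp: F_def PiE_iff extensional_def)
  have GS: "snd (G x) \<in> {..<N} \<rightarrow>\<^sub>E {0..<n}" for x
    using n by (auto simp: G_def PiE_iff extensional_def)
  have "bij_betw F ({0..<n} \<times> ker_mod n ?M') (ker_mod n M)"
  proof (rule bij_betw_byWitness[where f' = G])
    show "\<forall>a\<in>{0..<n} \<times> ker_mod n ?M'. G (F a) = a"
      unfolding ker_mod_def dims by (auto simp: F_def G_def mod_simps fun_eq_iff PiE_iff extensional_def)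
    show "\<forall>x\<in>ker_mod n M. F (G x) = x"
      using M by (auto simp: F_def G_def ker_mod_def mod_simps fun_eq_iff PiE_iff extensional_def)
    show "F ` ({0..<n} \<times> ker_mod n ?M') \<subseteq> ker_mod n M"
    proof (clarify)
      fix t y assume t: "t \<in> {0..<n}" and y: "y \<in> ker_mod n ?M'"
      have "F (t, y) \<in> ker_mod n M \<longleftrightarrow> y \<in> ker_mod n ?M'"
        using y by (intro mem FS t) (auto simp: ker_mod_def[of _ ?M'] dims F_def cong_def mod_simps simp del: mat_delete_dim)
      with y show "F (t, y) \<in> ker_mod n M" by simp
    qed
    show "G ` ker_mod n M \<subseteq> {0..<n} \<times> ker_mod n ?M'"
    proof (rule image_subsetI)
      fix x assume x: "x \<in> ker_mod n M"
      then have "x \<in> {..<Suc N} \<rightarrow>\<^sub>E {0..<n}" using M by (simp add: ker_mod_def)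
      then have "x N \<in> {0..<n}" by (rule PiE_mem) simp
      then have "fst (G x) \<in> {0..<n}" by (simp add: G_def)
      moreover have "x \<in> ker_mod n M \<longleftrightarrow> snd (G x) \<in> ker_mod n ?M'"
        using x M by (intro mem GS) (auto simp: ker_mod_def G_def cong_def mod_simps)
      ultimately show "G x \<in> {0..<n} \<times> ker_mod n ?M'" using x by (simp only: mem_Times_iff)
    qed
  qed
  then have "card (ker_mod n M) = card ({0..<n} \<times> ker_mod n ?M')"
    by (simp add: bij_betw_same_card)
  then show ?thesis by (simp add: card_cartesian_product)
qed

section \<open>Alexander numberings of planar diagrams\<close>

text \<open>\<open>orbit\<close> begins with the first iterate, so a point lies in its own orbit
  only if it recurs, which the pigeonhole principle and injectivity guarantee.\<close>

lemma self_in_orbit_finite: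
  assumes "finite S" "bij_betw f S S" "x \<in> S"
  shows "x \<in> Orbits.orbit f x"
proof -
  have bij: "bij_betw (f ^^ n) S S" for n using assms(2) by (rule bij_betw_funpow)
  have "range (\<lambda>n. (f ^^ n) x) \<subseteq> S"
    using bij assms(3) by (auto dest: bij_betwE)
  then have "\<not> inj (\<lambda>n. (f ^^ n) x)"
    using range_inj_infinite[of "\<lambda>n. (f ^^ n) x"] finite_subset[OF _ assms(1)] by auto
  then obtain i j where ij: "i < j" "(f ^^ i) x = (f ^^ j) x"
    using linorder_injI[of "\<lambda>n. (f ^^ n) x"] by blast
  have "j = i + (j - i)" using ij(1) by simp
  then have "(f ^^ j) x = (f ^^ i) ((f ^^ (j - i)) x)"
    by (metis funpow_add o_apply)
  moreover have "(f ^^ (j - i)) x \<in> S" using bij assms(3) bij_betwE by blast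
  ultimately have "x = (f ^^ (j - i)) x"
    using ij(2) assms(3) bij_betw_imp_inj_on[OF bij[of i]] by (auto dest: inj_onD)
  then show ?thesis using ij(1) by (auto simp: orbit_altdef)
qed

section \<open>Traversing a signed Gauss code\<close>

locale diagram =
  fixes D :: gauss_code
  assumes well_formed: "well_formed D"
begin

abbreviation "len \<equiv> length (passages D)"
abbreviation "prv \<equiv> prev_pos D"
abbreviation "ov c \<equiv> pos D (c, Over)"
abbreviation "un c \<equiv> pos D (c, Under)"

lemma len_pos: "0 < len"
  using well_formed by (simp add: well_formed_def)

lemma pos_nth: "i < len \<Longrightarrow> pos D (passages D ! i) = i"
  using well_formed unfolding pos_def well_formed_def
  by (intro the_equality) (auto simp: nth_eq_iff_index_eq)

lemma pos_props:
  assumes "c \<in> crossings D"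
  shows "pos D (c, l) < len" "passages D ! pos D (c, l) = (c, l)"
proof -
  have "(c, l) \<in> set (passages D)"
    using well_formed assms by (cases l) (auto simp: well_formed_def)
  then obtain i where "i < len" "passages D ! i = (c, l)" by (auto simp: in_set_conv_nth)
  with pos_nth show "pos D (c, l) < len" "passages D ! pos D (c, l) = (c, l)" by force+
qed

lemma position_cases:
  assumes "i < len"
  obtains c where "c \<in> crossings D" "i = ov c" | c where "c \<in> crossings D" "i = un c"
proof -
  obtain c l where cl: "passages D ! i = (c, l)" by force
  have "c \<in> crossings D" using assms cl nth_mem[OF assms] by (force simp: crossings_def)
  moreover have "i = pos D (c, l)" using pos_nth[OF assms] cl by simp
  ultimately show thesis using that by (cases l) auto
qed

lemma finite_crossings [simp]: "finite (crossings D)"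
  by (simp add: crossings_def)

text \<open>Links local and global counts: sums along the knot, where differences cancel cyclically,
  are regrouped by crossings, each of which is passed exactly twice.\<close>

lemma sum_positions:
  fixes F :: "nat \<Rightarrow> 'a :: comm_monoid_add"
  shows "(\<Sum>i<len. F i) = (\<Sum>c\<in>crossings D. F (ov c) + F (un c))"
proof -
  have split: "{..<len} = ov ` crossings D \<union> un ` crossings D"
    using pos_props(1) by (auto elim: position_cases)
  have "ov c \<noteq> un c'" if "c \<in> crossings D" "c' \<in> crossings D" for c c'
    using pos_props(2)[OF that(1), of Over] pos_props(2)[OF that(2), of Under] by auto
  then have disj: "ov ` crossings D \<inter> un ` crossings D = {}" by blast
  have inj: "inj_on (\<lambda>c. pos D (c, l)) (crossings D)" for l
    by (rule inj_onI) (metis pos_props(2) prod.inject)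
  show ?thesis
    unfolding split using disj inj by (simp add: sum.union_disjoint sum.reindex sum.distrib)
qed

lemma len_eq: "len = 2 * card (crossings D)"
  using sum_positions[of "\<lambda>_. 1 :: nat"] by simp

lemma prv_less: "prv i < len"
  using len_pos by (simp add: prev_pos_def)

lemma next_prv [simp]: "i < len \<Longrightarrow> next_pos D (prv i) = i"
  using len_pos by (simp add: prev_pos_def next_pos_def mod_simps)

lemma prv_next [simp]: "i < len \<Longrightarrow> prv (next_pos D i) = i"
  using len_pos by (cases "i + 1 = len") (auto simp: prev_pos_def next_pos_def)

lemma next_less: "next_pos D i < len"
  using len_pos by (simp add: next_pos_def)

lemma bij_prv: "bij_betw prv {..<len} {..<len}"
  by (rule bij_betw_byWitness[where f' = "next_pos D"]) (auto simp: prv_less next_less)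

text \<open>A knot is one closed curve, so a quantity unchanged modulo q at every passage is
  constant along all edges.\<close>

lemma prv_cycle_induct:
  fixes q :: int
  assumes "\<And>i. i < len \<Longrightarrow> q dvd g i - g (prv i)" "e < len"
  shows "q dvd g e - g 0"
  using assms(2)
proof (induction e)
  case (Suc e)
  have "prv (Suc e) = e" using Suc.prems by (simp add: prev_pos_def)
  then have "q dvd (g (Suc e) - g e) + (g e - g 0)"
    using assms(1)[OF Suc.prems] Suc by (intro dvd_add) auto
  then show ?case by simp
qed simp

section \<open>Darts and regions around a crossing\<close>

lemma partner_pos: "c \<in> crossings D \<Longrightarrow> partner D (pos D (c, l)) = pos D (c, other_level l)"
  by (simp add: partner_def pos_props)

text \<open>One equation for each of the four corners: the four darts arriving at the crossing are
  matched with the four darts leaving it.\<close>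

lemma turn_left_positive:
  assumes "c \<in> crossings D" "positive D c"
  shows "turn_left D (prv (ov c), True) = (un c, True)"
    "turn_left D (ov c, False) = (prv (un c), False)"
    "turn_left D (prv (un c), True) = (prv (ov c), False)"
    "turn_left D (un c, False) = (ov c, True)"
  using assms by (simp_all add: Let_def partner_pos pos_props other_goes_left_def)

lemma turn_left_negative:
  assumes "c \<in> crossings D" "\<not> positive D c"
  shows "turn_left D (prv (un c), True) = (ov c, True)"
    "turn_left D (un c, False) = (prv (ov c), False)"
    "turn_left D (prv (ov c), True) = (prv (un c), False)"
    "turn_left D (ov c, False) = (un c, True)"
  using assms by (simp_all add: Let_def partner_pos pos_props other_goes_left_def)

abbreviation "darts \<equiv> {..<len} \<times> (UNIV :: bool set)"

text \<open>Every dart leaves some crossing and is there the left turn of an arriving dart. On a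
  finite set this surjectivity already gives bijectivity.\<close>

lemma bij_turn_left: "bij_betw (turn_left D) darts darts"
proof -
  have img: "turn_left D (e, b) \<in> turn_left D ` darts" if "e < len" for e b
    using that by (intro imageI) auto
  have img_prv: "turn_left D (prv e, b) \<in> turn_left D ` darts" for e b
    using prv_less by (rule img)
  have surj: "darts \<subseteq> turn_left D ` darts"
  proof (clarify)
    fix e b assume e: "e < len"
    show "(e, b) \<in> turn_left D ` darts"
    proof (cases b)
      case True
      from e show ?thesis
      proof (cases rule: position_cases)
        case (1 c)
        then show ?thesis
          using True img[OF pos_props(1), of c Under False] img_prv[of "un c" True]
          by (cases "positive D c") (simp_all only: turn_left_positive turn_left_negative simp_thms True_implies_equals)
      next
        case (2 c)
        then show ?thesis
          using True img[OF pos_props(1), of c Over False] img_prv[of "ov c" True]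
          by (cases "positive D c") (simp_all only: turn_left_positive turn_left_negative simp_thms True_implies_equals)
      qed
    next
      case False
      \<comment> \<open>A backward dart on \<open>e\<close> leaves the crossing at the end of
        \<open>e\<close>, hence the shift by one position.\<close>
      have "next_pos D e < len" by (rule next_less)
      then show ?thesis
      proof (cases rule: position_cases)
        case (1 c)
        then have "e = prv (ov c)" using prv_next[OF e] by simp
        then show ?thesis
          using 1(1) False img[OF pos_props(1), of c Under False] img_prv[of "un c" True]
          by (cases "positive D c") (simp_all only: turn_left_positive turn_left_negative simp_thms True_implies_equals)
      next
        case (2 c)
        then have "e = prv (un c)" using prv_next[OF e] by simp
        then show ?thesis
          using 2(1) False img[OF pos_props(1), of c Over False] img_prv[of "ov c" True]
          by (cases "positive D c") (simp_all only: turn_left_positive turn_left_negative simp_thms True_implies_equals)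
      qed
    qed
  qed
  have fin: "finite darts" by simp
  have "darts = turn_left D ` darts"
    using surj fin by (intro card_seteq card_image_le finite_imageI)
  moreover have "inj_on (turn_left D) darts" using finite_surj_inj[OF fin surj] .
  ultimately show ?thesis by (simp add: bij_betw_def)
qed

lemma orbit_turn_left:
  assumes "d \<in> darts"
  shows "Orbits.orbit (turn_left D) (turn_left D d) = Orbits.orbit (turn_left D) d"
  using self_in_orbit_finite[OF _ bij_turn_left assms] by (intro self_in_orbit_step) auto

text \<open>
  Functions on regions are represented by functions on darts that are constant along boundaries
  of regions.
\<close>

definition region_fun :: "(nat \<times> bool \<Rightarrow> int) \<Rightarrow> bool" where
  "region_fun h \<longleftrightarrow> (\<forall>d\<in>darts. h (turn_left D d) = h d)"

text \<open>\<open>(e, True)\<close> represents the region to the left of the edge and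
  \<open>(e, False)\<close> the one to its right, so this is the change of \<open>h\<close> on
  crossing the edge from right to left.\<close>

definition jump :: "(nat \<times> bool \<Rightarrow> int) \<Rightarrow> nat \<Rightarrow> int" where
  "jump h e = h (e, True) - h (e, False)"

lemma region_funD: "region_fun h \<Longrightarrow> e < len \<Longrightarrow> h (turn_left D (e, b)) = h (e, b)"
  unfolding region_fun_def by blast

lemma region_fun_positive:
  assumes "region_fun h" "c \<in> crossings D" "positive D c"
  shows "h (prv (ov c), True) = h (un c, True)" "h (ov c, False) = h (prv (un c), False)"
    "h (prv (un c), True) = h (prv (ov c), False)" "h (un c, False) = h (ov c, True)"
  using region_funD[OF assms(1) prv_less[of "ov c"], of True]
    region_funD[OF assms(1) pos_props(1)[OF assms(2), of Over], of False]
    region_funD[OF assms(1) prv_less[of "un c"], of True]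
    region_funD[OF assms(1) pos_props(1)[OF assms(2), of Under], of False]
  by (simp_all only: turn_left_positive[OF assms(2,3)])

lemma region_fun_negative:
  assumes "region_fun h" "c \<in> crossings D" "\<not> positive D c"
  shows "h (prv (un c), True) = h (ov c, True)" "h (un c, False) = h (prv (ov c), False)"
    "h (prv (ov c), True) = h (prv (un c), False)" "h (ov c, False) = h (un c, True)"
  using region_funD[OF assms(1) prv_less[of "un c"], of True]
    region_funD[OF assms(1) pos_props(1)[OF assms(2), of Under], of False]
    region_funD[OF assms(1) prv_less[of "ov c"], of True]
    region_funD[OF assms(1) pos_props(1)[OF assms(2), of Over], of False]
  by (simp_all only: turn_left_negative[OF assms(2,3)])

text \<open>Walking once around the crossing returns to the same region, so the changes across its
  four edges cancel.\<close>

lemma jump_balance: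
  assumes "region_fun h" "c \<in> crossings D"
  shows "jump h (un c) - jump h (prv (un c)) = - (jump h (ov c) - jump h (prv (ov c)))"
  using region_fun_positive[OF assms] region_fun_negative[OF assms]
  by (cases "positive D c") (simp_all add: jump_def)

text \<open>By \<open>jump_balance\<close> a vanishing change along the over-strand forces one along
  the under-strand, so a single congruence for each crossing controls both of its passages.\<close>

lemma jump_constant:
  assumes "region_fun h" "\<And>c. c \<in> crossings D \<Longrightarrow> q dvd jump h (ov c) - jump h (prv (ov c))" "e < len"
  shows "q dvd jump h e - jump h 0"
proof (rule prv_cycle_induct[OF _ assms(3)])
  fix i assume "i < len"
  then show "q dvd jump h i - jump h (prv i)"
  proof (cases rule: position_cases)
    case (2 c)
    then show ?thesis using assms(2) jump_balance[OF assms(1)] by (metis dvd_minus_iff)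
  qed (use assms(2) in auto)
qed

text \<open>At a passage the left regions before and after it are separated by one edge of the other
  strand, so they agree modulo q when that jump vanishes. The right regions agree with the left ones
  by the jump across \<open>e\<close>.\<close>

lemma region_fun_constant:
  assumes "region_fun h" "\<And>e. e < len \<Longrightarrow> q dvd jump h e" "e < len"
  shows "q dvd h (e, b) - h (0, True)"
proof -
  have "q dvd h (e, True) - h (0, True)"
  proof (rule prv_cycle_induct[where g = "\<lambda>e. h (e, True)", OF _ assms(3)])
    fix i assume "i < len"
    then show "q dvd h (i, True) - h (prv i, True)"
    proof (cases rule: position_cases)
      case (1 c)
      then have "q dvd jump h (un c)" "q dvd jump h (prv (un c))" using assms(2) pos_props(1) prv_less by auto
      then show ?thesis
        using 1 region_fun_positive[OF assms(1), of c] region_fun_negative[OF assms(1), of c]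
        by (cases "positive D c") (auto simp: jump_def dvd_diff_commute)
    next
      case (2 c)
      then have "q dvd jump h (ov c)" "q dvd jump h (prv (ov c))" using assms(2) pos_props(1) prv_less by auto
      then show ?thesis
        using 2 region_fun_positive[OF assms(1), of c] region_fun_negative[OF assms(1), of c]
        by (cases "positive D c") (auto simp: jump_def dvd_diff_commute)
    qed
  qed
  moreover from this have "q dvd h (e, False) - h (0, True)"
    using dvd_diff[of q "h (e, True) - h (0, True)" "h (e, True) - h (e, False)"] assms(2,3)
    by (simp add: jump_def)
  ultimately show ?thesis by (cases b) simp_all
qed

text \<open>
  For a planar diagram there are as many functions from regions to \<open>\<int>/q\<close> as there are data
  consisting of the value at one region, one jump, and the change of the jump at every crossing.
  Since these data determine the function, they can be prescribed arbitrarily.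
\<close>

lemma alexander_numbering:
  assumes planar: "int (card (crossings D)) - int (card (edges D)) + int (card (regions D)) = 2"
    and q: "q > 0"
  shows "\<exists>h. region_fun h \<and> (\<forall>e<len. [h (e, True) = h (e, False) + 1] (mod q))"
proof -
  let ?orb = "Orbits.orbit (turn_left D)" and ?C = "crossings D"
  define H where "H \<phi> = (\<lambda>d. \<phi> (?orb d))" for \<phi> :: "(nat \<times> bool) set \<Rightarrow> int"
  define \<Theta> where "\<Theta> \<phi> = (H \<phi> (0, True), jump (H \<phi>) 0 mod q,
    \<lambda>c\<in>?C. (jump (H \<phi>) (ov c) - jump (H \<phi>) (prv (ov c))) mod q)" for \<phi>
  define P where "P = regions D \<rightarrow>\<^sub>E {0..<q}"
  define T where "T = {0..<q} \<times> {0..<q} \<times> (?C \<rightarrow>\<^sub>E {0..<q})"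
  have regions: "regions D = ?orb ` darts" by (simp add: regions_def edges_def)
  have fin: "finite (regions D)" by (simp add: regions)
  have rf: "region_fun (H \<phi>)" for \<phi>
    by (auto simp: region_fun_def H_def orbit_turn_left)
  \<comment> \<open>There are twice as many edges as crossings, so Euler characteristic 2 leaves two
    regions more than crossings. \<open>T\<close> has just as many coordinates: one value, one jump
    and a change for each crossing.\<close>
  have "card (regions D) = card ?C + 2"
    using planar len_eq by (simp add: edges_def)
  then have cards: "card P = card T"
    by (simp add: P_def T_def card_PiE fin card_cartesian_product)
  have "inj_on \<Theta> P"
  proof (rule inj_onI)
    fix \<phi> \<psi> assume \<phi>: "\<phi> \<in> P" and \<psi>: "\<psi> \<in> P" and eq: "\<Theta> \<phi> = \<Theta> \<psi>"
    define h where "h = (\<lambda>d. H \<phi> d - H \<psi> d)"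
    have h: "region_fun h" using rf by (auto simp: region_fun_def h_def)
    have jump: "jump h e = jump (H \<phi>) e - jump (H \<psi>) e" for e by (simp add: jump_def h_def)
    have "q dvd jump h (ov c) - jump h (prv (ov c))" if "c \<in> ?C" for c
    proof -
      from eq have "(\<lambda>c\<in>?C. (jump (H \<phi>) (ov c) - jump (H \<phi>) (prv (ov c))) mod q) c =
          (\<lambda>c\<in>?C. (jump (H \<psi>) (ov c) - jump (H \<psi>) (prv (ov c))) mod q) c"
        by (simp add: \<Theta>_def)
      with that have "q dvd (jump (H \<phi>) (ov c) - jump (H \<phi>) (prv (ov c))) - (jump (H \<psi>) (ov c) - jump (H \<psi>) (prv (ov c)))"
        by (simp add: mod_eq_dvd_iff)
      then show ?thesis by (simp add: jump algebra_simps)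
    qed
    from jump_constant[OF h this] have "q dvd jump h e - jump h 0" if "e < len" for e using that by blast
    moreover have "q dvd jump h 0" using eq by (simp add: \<Theta>_def jump mod_eq_dvd_iff)
    ultimately have "q dvd jump h e" if "e < len" for e using that by (metis dvd_diff_commute dvd_add_right_iff diff_add_cancel)
    from region_fun_constant[OF h this] have "q dvd h (e, b) - h (0, True)" if "e < len" for e b using that by blast
    moreover have "h (0, True) = 0" using eq by (simp add: h_def \<Theta>_def)
    ultimately have dvd: "q dvd h (e, b)" if "e < len" for e b using that by simp
    show "\<phi> = \<psi>"
    proof
      fix r
      show "\<phi> r = \<psi> r"
      proof (cases "r \<in> regions D")
        case True
        then obtain e b where "e < len" "r = ?orb (e, b)" by (auto simp: regions)
        then have "q dvd \<phi> r - \<psi> r" using dvd[of e b] by (simp add: h_def H_def)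
        then have "\<phi> r mod q = \<psi> r mod q" by (simp add: mod_eq_dvd_iff)
        moreover have "\<phi> r \<in> {0..<q}" "\<psi> r \<in> {0..<q}"
          using \<phi> \<psi> True unfolding P_def by (meson PiE_mem)+
        ultimately show ?thesis by simp
      next
        case False
        then show ?thesis using \<phi> \<psi> by (auto simp: P_def PiE_def extensional_def)
      qed
    qed
  qed
  moreover have "\<Theta> ` P \<subseteq> T"
  proof (rule image_subsetI)
    fix \<phi> assume \<phi>: "\<phi> \<in> P"
    have "H \<phi> (0, True) \<in> {0..<q}"
      using \<phi> len_pos unfolding P_def H_def by (intro PiE_mem[OF \<phi>[unfolded P_def]]) (auto simp: regions)
    then show "\<Theta> \<phi> \<in> T" using q by (auto simp: \<Theta>_def T_def)
  qed
  moreover have "finite T" unfolding T_def by (intro finite_cartesian_product finite_PiE) auto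
  ultimately have "\<Theta> ` P = T"
    by (simp add: card_image cards card_subset_eq)
  \<comment> \<open>The data of an Alexander numbering: jump 1 at edge 0 and no change at any
    crossing. The jump is written \<open>1 mod q\<close> because q may be 1.\<close>
  moreover have "(0, 1 mod q, \<lambda>c\<in>?C. 0) \<in> T" using q by (auto simp: T_def)
  ultimately obtain \<phi> where \<phi>: "\<Theta> \<phi> = (0, 1 mod q, \<lambda>c\<in>?C. 0)" by (metis imageE)
  have "q dvd jump (H \<phi>) (ov c) - jump (H \<phi>) (prv (ov c))" if "c \<in> ?C" for c
  proof -
    have "(\<lambda>c\<in>?C. (jump (H \<phi>) (ov c) - jump (H \<phi>) (prv (ov c))) mod q) c = (\<lambda>c\<in>?C. 0) c"
      using \<phi> by (simp add: \<Theta>_def)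
    with that show ?thesis by (simp add: dvd_eq_mod_eq_0)
  qed
  from jump_constant[OF rf this] have const: "q dvd jump (H \<phi>) e - jump (H \<phi>) 0" if "e < len" for e using that by blast
  have "q dvd jump (H \<phi>) 0 - 1" using \<phi> by (simp add: \<Theta>_def mod_eq_dvd_iff)
  then have "q dvd (jump (H \<phi>) e - jump (H \<phi>) 0) + (jump (H \<phi>) 0 - 1)" if "e < len" for e
    using const[OF that] by (intro dvd_add)
  then have "[H \<phi> (e, True) = H \<phi> (e, False) + 1] (mod q)" if "e < len" for e
    using that by (simp add: cong_iff_dvd_diff jump_def algebra_simps)
  then show ?thesis using rf by blast
qed

lemma arc_prv_over:
  assumes "c \<in> crossings D"
  shows "arc D (prv (ov c)) = arc D (ov c)"
proof -
  have "(prv (ov c), ov c) \<in> joined D"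
    using assms pos_props[OF assms] prv_less by (auto simp: joined_def edges_def intro!: exI[of _ "prv (ov c)"])
  then show ?thesis unfolding arc_def
    by (auto intro: converse_rtrancl_into_rtrancl)
qed

end

text \<open>
  The entries of the colouring matrix at an integer \<open>m\<close>, with the rows of negative crossings
  multiplied by \<open>m\<close> to clear denominators.
\<close>

definition cleared_entry :: "int \<Rightarrow> gauss_code \<Rightarrow> nat \<Rightarrow> nat set \<Rightarrow> int" where
  "cleared_entry m D c a =
     (if a = in_arc D c then (if positive D c then m else 1) else 0)
     + (if a = over_arc D c then (if positive D c then 1 - m else m - 1) else 0)
     + (if a = out_arc D c then (if positive D c then - 1 else - m) else 0)"

text \<open>Each edge gets as weight a power of m whose exponent is minus the number of the region
  to its right. The weighted row of a crossing is then, modulo n, the weights of its two incoming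
  edges minus those of its two outgoing edges, each placed at its arc. Every edge comes in once and
  goes out once, so the sum over all crossings cancels.\<close>

lemma (in diagram) crossing_relation:
  assumes planar: "int (card (crossings D)) - int (card (edges D)) + int (card (regions D)) = 2"
    and n: "n > 0" and cop: "coprime n m"
  shows "\<exists>w. (\<forall>c\<in>crossings D. coprime (w c) n) \<and>
             (\<forall>a. n dvd (\<Sum>c\<in>crossings D. w c * cleared_entry m D c a))"
proof -
  \<comment> \<open>Since m is a unit modulo n, Euler's theorem makes its powers periodic with
    period q. Exponents given modulo q are thus meaningful, and reducing them in \<open>E\<close>
    replaces negative powers by integers.\<close>
  define q where "q = int (totient (nat n))"
  have q: "q > 0" using n by (simp add: q_def)
  have mq: "[m ^ nat q = 1] (mod n)"
  proof (cases "n = 1")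
    case False
    then have "residues n" using n by (simp add: residues_def)
    from residues.euler_theorem[OF this, of m] show ?thesis
      using cop by (simp add: q_def coprime_commute)
  qed simp
  define E where "E k = m ^ nat (k mod q)" for k
  have E_cong: "E k = E l" if "[k = l] (mod q)" for k l
    using that by (simp add: E_def cong_def)
  have E_Suc: "[E k = m * E l] (mod n)" if "[k = l + 1] (mod q)" for k l
  proof -
    have k: "k mod q = (l mod q + 1) mod q" using that by (simp add: cong_def mod_simps)
    have l: "0 \<le> l mod q" "l mod q < q" using q by auto
    show ?thesis
    proof (cases "l mod q + 1 = q")
      case True
      then have "nat q = Suc (nat (l mod q))" using l by linarith
      then have "m * E l = m ^ nat q" by (simp add: E_def)
      moreover have "E k = 1" using True k by (simp add: E_def)
      ultimately show ?thesis using mq by (simp add: cong_sym)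
    next
      case False
      then have "k mod q = l mod q + 1" using k l by simp
      then have "E k = m * E l" using l by (simp add: E_def nat_add_distrib)
      then show ?thesis by simp
    qed
  qed
  obtain h where h: "region_fun h" "\<And>e. e < len \<Longrightarrow> [h (e, True) = h (e, False) + 1] (mod q)"
    using alexander_numbering[OF planar q] by blast
  define g where "g e = E (- h (e, False))" for e
  define w where "w c = (if positive D c then g (un c) else g (ov c))" for c
  have local: "n dvd w c * cleared_entry m D c a -
      ((if a = arc D (prv (ov c)) then g (prv (ov c)) else 0) - (if a = arc D (ov c) then g (ov c) else 0)
      + ((if a = arc D (prv (un c)) then g (prv (un c)) else 0) - (if a = arc D (un c) then g (un c) else 0)))"
    if c: "c \<in> crossings D" for c a
  proof -
    note lt = pos_props(1)[OF c, of Over] pos_props(1)[OF c, of Under] prv_less[of "ov c"] prv_less[of "un c"]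
    have dvd: "q dvd h (e, True) - (h (e, False) + 1)" if "e < len" for e
      using h(2)[OF that] by (simp add: cong_iff_dvd_diff)
    note dvds = lt[THEN dvd]
    show ?thesis
    proof (cases "positive D c")
      case True
      \<comment> \<open>With G the weight of the outgoing under-edge, the incoming over-edge also
        has weight G, and the other two edges have weight \<open>m * G\<close> modulo n. At a
        negative crossing the over- and under-strands exchange these roles.\<close>
      note r = region_fun_positive[OF h(1) c True]
      have 1: "g (ov c) = g (prv (un c))" using r by (simp add: g_def)
      have "q dvd (h (prv (ov c), True) - (h (prv (ov c), False) + 1)) - (h (un c, True) - (h (un c, False) + 1))"
        using dvds(3,2) by (rule dvd_diff)
      then have 2: "g (prv (ov c)) = g (un c)"
        unfolding g_def using r by (intro E_cong) (simp add: cong_iff_dvd_diff algebra_simps dvd_diff_commute)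
      have "[g (ov c) = m * g (un c)] (mod n)"
        unfolding g_def using r dvds by (intro E_Suc) (simp add: cong_iff_dvd_diff algebra_simps)
      then obtain t where t: "g (prv (un c)) = m * g (un c) + n * t"
        unfolding 1 by (metis cong_iff_lin cong_sym)
      \<comment> \<open>The three arcs at a crossing may coincide, so the identity is checked for
        all truth values of the tests \<open>P\<close>, \<open>Q\<close>, \<open>R\<close>.\<close>
      have "n dvd G * ((if P then m else 0) + (if Q then 1 - m else 0) + (if R then - 1 else 0))
          - ((if Q then G else 0) - (if Q then m * G + n * t else 0)
             + ((if P then m * G + n * t else 0) - (if R then G else 0)))" for P Q R G
        by (cases P; cases Q; cases R) (simp_all add: algebra_simps)
      then show ?thesis
        by (simp only: cleared_entry_def w_def in_arc_def out_arc_def over_arc_def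
            arc_prv_over[OF c] 1 2 t True if_True)
    next
      case False
      note r = region_fun_negative[OF h(1) c False]
      have 1: "g (un c) = g (prv (ov c))" using r by (simp add: g_def)
      have "q dvd (h (prv (un c), True) - (h (prv (un c), False) + 1)) - (h (ov c, True) - (h (ov c, False) + 1))"
        using dvds(4,1) by (rule dvd_diff)
      then have 2: "g (prv (un c)) = g (ov c)"
        unfolding g_def using r by (intro E_cong) (simp add: cong_iff_dvd_diff algebra_simps dvd_diff_commute)
      have "[g (un c) = m * g (ov c)] (mod n)"
        unfolding g_def using r dvds by (intro E_Suc) (simp add: cong_iff_dvd_diff algebra_simps)
      then obtain t where t: "g (prv (ov c)) = m * g (ov c) + n * t"
        unfolding 1 by (metis cong_iff_lin cong_sym)
      have "n dvd G * ((if P then 1 else 0) + (if Q then m - 1 else 0) + (if R then - m else 0))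
          - ((if Q then m * G + n * t else 0) - (if Q then G else 0)
             + ((if P then G else 0) - (if R then m * G + n * t else 0)))" for P Q R G
        by (cases P; cases Q; cases R) (simp_all add: algebra_simps)
      then show ?thesis
        by (simp only: cleared_entry_def w_def in_arc_def out_arc_def over_arc_def
            arc_prv_over[OF c] 1 2 t False if_False)
    qed
  qed
  have "n dvd (\<Sum>c\<in>crossings D. w c * cleared_entry m D c a)" for a
  proof -
    define \<phi> where "\<phi> e = (if a = arc D e then g e else 0)" for e
    have "(\<Sum>c\<in>crossings D. (\<phi> (prv (ov c)) - \<phi> (ov c)) + (\<phi> (prv (un c)) - \<phi> (un c))) = (\<Sum>i<len. \<phi> (prv i) - \<phi> i)"
      by (rule sum_positions[symmetric])
    also have "\<dots> = (\<Sum>i<len. \<phi> (prv i)) - (\<Sum>i<len. \<phi> i)" by (rule sum_subtractf)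
    also have "\<dots> = 0" using sum.reindex_bij_betw[OF bij_prv, of \<phi>] by simp
    finally have 0: "(\<Sum>c\<in>crossings D. (\<phi> (prv (ov c)) - \<phi> (ov c)) + (\<phi> (prv (un c)) - \<phi> (un c))) = 0" .
    have "n dvd (\<Sum>c\<in>crossings D. w c * cleared_entry m D c a
        - ((\<phi> (prv (ov c)) - \<phi> (ov c)) + (\<phi> (prv (un c)) - \<phi> (un c))))"
      unfolding \<phi>_def by (intro dvd_sum local)
    then show ?thesis by (simp only: sum_subtractf 0 diff_0_right)
  qed
  moreover have "coprime (w c) n" for c
    using cop by (simp add: w_def g_def E_def coprime_commute)
  ultimately show ?thesis by blast
qed

section \<open>Evaluation of Laurent polynomials\<close>

text \<open>Rational values accommodate the negative powers of m. At nonzero points this is a ring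
  homomorphism and so commutes with determinants.\<close>

definition eval_at :: "rat \<Rightarrow> laurent \<Rightarrow> rat" where
  "eval_at x p = (\<Sum>k\<in>Poly_Mapping.keys p. of_int (Poly_Mapping.lookup p k) * x powi k)"

lemma eval_at_superset:
  assumes "finite K" "Poly_Mapping.keys p \<subseteq> K"
  shows "eval_at x p = (\<Sum>k\<in>K. of_int (Poly_Mapping.lookup p k) * x powi k)"
  unfolding eval_at_def using assms by (intro sum.mono_neutral_left) (auto simp: in_keys_iff)

lemma eval_at_0 [simp]: "eval_at x 0 = 0"
  by (simp add: eval_at_def)

lemma eval_at_mpow [simp]: "eval_at x (mpow k) = x powi k"
  by (simp add: eval_at_def mpow_def)

lemma eval_at_add: "eval_at x (p + q) = eval_at x p + eval_at x q"
proof -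
  let ?K = "Poly_Mapping.keys p \<union> Poly_Mapping.keys q"
  have "eval_at x (p + q) = (\<Sum>k\<in>?K. of_int (Poly_Mapping.lookup (p + q) k) * x powi k)"
    using Poly_Mapping.keys_add[of p q] by (intro eval_at_superset) auto
  also have "\<dots> = (\<Sum>k\<in>?K. of_int (Poly_Mapping.lookup p k) * x powi k)
      + (\<Sum>k\<in>?K. of_int (Poly_Mapping.lookup q k) * x powi k)"
    by (simp add: lookup_add distrib_right sum.distrib)
  also have "\<dots> = eval_at x p + eval_at x q"
    by (simp add: eval_at_superset[of ?K])
  finally show ?thesis .
qed

lemma eval_at_uminus: "eval_at x (- p) = - eval_at x p"
  using eval_at_add[of x p "- p"] by simp

lemma eval_at_diff: "eval_at x (p - q) = eval_at x p - eval_at x q"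
  using eval_at_add[of x p "- q"] by (simp add: eval_at_uminus)

text \<open>Laurent polynomials form the free abelian group on the exponents; both sides are
  additive in each factor, so monomials suffice.\<close>

lemma eval_at_mult:
  assumes "x \<noteq> 0"
  shows "eval_at x (p * q) = eval_at x p * eval_at x q"
proof (rule frag_induction[of p UNIV])
  fix k
  show "eval_at x (frag_of k * q) = eval_at x (frag_of k) * eval_at x q"
  proof (rule frag_induction[of q UNIV])
    fix l
    have "frag_of k * frag_of l = mpow (k + l)"
      by (simp add: mpow_def mult_single)
    moreover have "frag_of k = mpow k" "frag_of l = mpow l" by (simp_all add: mpow_def)
    ultimately show "eval_at x (frag_of k * frag_of l) = eval_at x (frag_of k) * eval_at x (frag_of l)"
      using assms by (simp add: power_int_add)
  qed (simp_all add: right_diff_distrib eval_at_diff)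
qed (simp_all add: left_diff_distrib eval_at_diff)

lemma eval_at_1 [simp]: "eval_at x 1 = 1"
  using eval_at_mpow[of x 0] by (simp add: mpow_def)

lemma comm_ring_hom_eval_at: "x \<noteq> 0 \<Longrightarrow> comm_ring_hom (eval_at x)"
  by unfold_locales (simp_all add: eval_at_add eval_at_mult)

lemma det_row_scale:
  fixes B :: "'a :: comm_ring_1 mat"
  assumes "B \<in> carrier_mat n n"
  shows "det (mat n n (\<lambda>(i, j). d i * B $$ (i, j))) = (\<Prod>i<n. d i) * det B"
proof -
  let ?B = "mat n n (\<lambda>(i, j). d i * B $$ (i, j))"
  have "signof p * (\<Prod>i = 0..<n. ?B $$ (i, p i)) = (\<Prod>i<n. d i) * (signof p * (\<Prod>i = 0..<n. B $$ (i, p i)))"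
    if "p permutes {0..<n}" for p
  proof -
    have "(\<Prod>i = 0..<n. ?B $$ (i, p i)) = (\<Prod>i = 0..<n. d i * B $$ (i, p i))"
      using permutes_in_image[OF that] by (intro prod.cong) auto
    then show ?thesis by (simp add: prod.distrib atLeast0LessThan ac_simps)
  qed
  then show ?thesis
    using assms by (simp add: det_def sum_distrib_left)
qed

text \<open>The passage to \<open>nat k\<close> is faithful only without negative exponents, which
  the normalization of the Alexander polynomial ensures.\<close>

definition value_poly :: "laurent \<Rightarrow> int poly" where
  "value_poly p = (\<Sum>k\<in>Poly_Mapping.keys p. Polynomial.monom (Poly_Mapping.lookup p k) (nat k))"

lemma coeff_value_poly:
  assumes "\<forall>j<0. Poly_Mapping.lookup p j = 0"
  shows "Polynomial.coeff (value_poly p) j = Poly_Mapping.lookup p (int j)"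
proof -
  have "Polynomial.coeff (value_poly p) j = (\<Sum>k\<in>Poly_Mapping.keys p. if k = int j then Poly_Mapping.lookup p k else 0)"
    unfolding value_poly_def coeff_sum
  proof (rule sum.cong[OF refl])
    fix k assume "k \<in> Poly_Mapping.keys p"
    then have "k \<ge> 0" using assms by (meson in_keys_iff not_less)
    then show "Polynomial.coeff (Polynomial.monom (Poly_Mapping.lookup p k) (nat k)) j = (if k = int j then Poly_Mapping.lookup p k else 0)"
      by auto
  qed
  also have "\<dots> = Poly_Mapping.lookup p (int j)"
    by (simp add: sum.delta' in_keys_iff)
  finally show ?thesis .
qed

lemma poly_value_poly:
  assumes "\<forall>j<0. Poly_Mapping.lookup p j = 0"
  shows "of_int (poly (value_poly p) m) = eval_at (of_int m) p"
  unfolding value_poly_def eval_at_def poly_sum of_int_sum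
proof (rule sum.cong[OF refl])
  fix k assume "k \<in> Poly_Mapping.keys p"
  then have "k \<ge> 0" using assms by (meson in_keys_iff not_less)
  then show "of_int (poly (Polynomial.monom (Poly_Mapping.lookup p k) (nat k)) m) = of_int (Poly_Mapping.lookup p k) * (of_int m :: rat) powi k"
    by (simp add: poly_monom power_int_def)
qed

lemma value_poly_inj:
  assumes "\<forall>j<0. Poly_Mapping.lookup p j = 0" "\<forall>j<0. Poly_Mapping.lookup q j = 0"
    and "value_poly p = value_poly q"
  shows "p = q"
proof (rule poly_mapping_eqI)
  fix j :: int
  show "Poly_Mapping.lookup p j = Poly_Mapping.lookup q j"
  proof (cases "j < 0")
    case False
    then show ?thesis
      using coeff_value_poly[OF assms(1), of "nat j"] coeff_value_poly[OF assms(2), of "nat j"] assms(3) by simp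
  qed (use assms in simp)
qed

section \<open>Counting colourings\<close>

context diagram
begin

lemma arcs_mem:
  assumes "c \<in> crossings D"
  shows "in_arc D c \<in> arcs D" "out_arc D c \<in> arcs D" "over_arc D c \<in> arcs D"
  using pos_props(1)[OF assms] prv_less
  by (auto simp: in_arc_def out_arc_def over_arc_def arcs_def edges_def)

lemma finite_arcs: "finite (arcs D)"
  by (simp add: arcs_def edges_def)

lemma sum_cleared_entry:
  assumes "c \<in> crossings D"
  shows "(\<Sum>a\<in>arcs D. cleared_entry m D c a * X a) =
    (if positive D c then m * X (in_arc D c) + (1 - m) * X (over_arc D c) - X (out_arc D c)
     else X (in_arc D c) + (m - 1) * X (over_arc D c) - m * X (out_arc D c))"
proof -
  have if_mult: "(if a = b then y else 0) * X a = (if a = b then y * X a else 0)" for a b and y :: int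
    by simp
  show ?thesis
    by (simp add: cleared_entry_def distrib_right sum.distrib if_mult sum.delta finite_arcs arcs_mem[OF assms])
qed

text \<open>At a negative crossing the equation involves the inverse of m; multiplying it by m, a
  unit modulo n, gives the cleared row.\<close>

lemma colouring_condition:
  assumes c: "c \<in> crossings D" and X: "X \<in> arcs D \<rightarrow>\<^sub>E {0..<n}" and cop: "coprime n m"
  shows "X (out_arc D c) =
      (if positive D c then quandle_op n m (X (in_arc D c)) (X (over_arc D c))
       else quandle_op' n m (X (in_arc D c)) (X (over_arc D c)))
    \<longleftrightarrow> n dvd (\<Sum>a\<in>arcs D. cleared_entry m D c a * X a)"
proof -
  let ?i = "X (in_arc D c)" and ?j = "X (over_arc D c)" and ?o = "X (out_arc D c)"
  have "?o \<in> {0..<n}" using X arcs_mem(2)[OF c] by (rule PiE_mem)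
  then have o: "?o mod n = ?o" by simp
  show ?thesis
  proof (cases "positive D c")
    case True
    have "?o = quandle_op n m ?i ?j \<longleftrightarrow> (m * ?i + (1 - m) * ?j) mod n = ?o mod n"
      by (auto simp: quandle_op_def o)
    then show ?thesis
      using True by (simp add: sum_cleared_entry[OF c] mod_eq_dvd_iff)
  next
    case False
    define \<mu> where "\<mu> = modular_inverse n m"
    have "[m * \<mu> = 1] (mod n)"
      unfolding \<mu>_def using cop by (intro cong_modular_inverse1) (simp add: coprime_commute)
    then obtain t where t: "m * \<mu> = 1 + n * t" by (metis cong_iff_lin cong_sym)
    have "?o = quandle_op' n m ?i ?j \<longleftrightarrow> (\<mu> * ?i + (1 - \<mu>) * ?j) mod n = ?o mod n"
      by (auto simp: quandle_op'_def o \<mu>_def)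
    also have "\<dots> \<longleftrightarrow> n dvd m * (\<mu> * ?i + (1 - \<mu>) * ?j - ?o)"
      using cop by (simp add: mod_eq_dvd_iff coprime_dvd_mult_right_iff)
    also have "m * (\<mu> * ?i + (1 - \<mu>) * ?j - ?o) = (m * \<mu>) * ?i + (m - m * \<mu>) * ?j - m * ?o"
      by (simp add: algebra_simps)
    also have "\<dots> = (?i + (m - 1) * ?j - m * ?o) + n * (t * (?i - ?j))"
      unfolding t by (simp add: algebra_simps)
    also have "n dvd \<dots> \<longleftrightarrow> n dvd ?i + (m - 1) * ?j - m * ?o"
      by (rule dvd_add_left_iff) simp
    finally show ?thesis
      using False by (simp add: sum_cleared_entry[OF c])
  qed
qed

lemma num_colourings_ker_mod:
  assumes row: "bij_betw \<rho> {..<N} (crossings D)" and col: "bij_betw \<kappa> {..<N} (arcs D)"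
    and cop: "coprime n m"
  shows "num_colourings n m D =
    card (ker_mod n (mat N N (\<lambda>(i, k). cleared_entry m D (\<rho> i) (\<kappa> k))))"
proof -
  let ?M = "mat N N (\<lambda>(i, k). cleared_entry m D (\<rho> i) (\<kappa> k))"
  define F where "F X = (\<lambda>k\<in>{..<N}. X (\<kappa> k))" for X :: "nat set \<Rightarrow> int"
  define G where "G x = (\<lambda>a\<in>arcs D. x (the_inv_into {..<N} \<kappa> a))" for x :: "nat \<Rightarrow> int"
  have col_mem: "\<kappa> k \<in> arcs D" if "k < N" for k using col that bij_betwE by fastforce
  have inv_mem: "the_inv_into {..<N} \<kappa> a < N" and col_inv: "\<kappa> (the_inv_into {..<N} \<kappa> a) = a"
    if "a \<in> arcs D" for a
    using col that the_inv_into_into[of \<kappa> "{..<N}" a "{..<N}"] f_the_inv_into_f_bij_betw[OF col, of a]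
    by (auto simp: bij_betw_def)
  have inv_col: "the_inv_into {..<N} \<kappa> (\<kappa> k) = k" if "k < N" for k
    using col that by (auto simp: bij_betw_def intro: the_inv_into_f_f)
  have sum: "(\<Sum>k<N. ?M $$ (i, k) * F X k) = (\<Sum>a\<in>arcs D. cleared_entry m D (\<rho> i) a * X a)"
    if "i < N" for i X
  proof -
    have "(\<Sum>k<N. ?M $$ (i, k) * F X k) = (\<Sum>k<N. cleared_entry m D (\<rho> i) (\<kappa> k) * X (\<kappa> k))"
      using that by (intro sum.cong) (auto simp: F_def)
    then show ?thesis
      using sum.reindex_bij_betw[OF col, of "\<lambda>a. cleared_entry m D (\<rho> i) a * X a"] by simp
  qed
  have mem: "F X \<in> ker_mod n ?M \<longleftrightarrow> X \<in> colourings n m D" if X: "X \<in> arcs D \<rightarrow>\<^sub>E {0..<n}" for X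
  proof -
    have "F X \<in> {..<N} \<rightarrow>\<^sub>E {0..<n}"
      unfolding F_def using PiE_mem[OF X col_mem] by auto
    then have "F X \<in> ker_mod n ?M \<longleftrightarrow> (\<forall>i<N. n dvd (\<Sum>a\<in>arcs D. cleared_entry m D (\<rho> i) a * X a))"
      using sum[of _ X] by (simp add: ker_mod_def)
    also have "\<dots> \<longleftrightarrow> (\<forall>c\<in>\<rho> ` {..<N}. n dvd (\<Sum>a\<in>arcs D. cleared_entry m D c a * X a))"
      by auto
    also have "\<rho> ` {..<N} = crossings D" using row by (simp add: bij_betw_def)
    also have "(\<forall>c\<in>crossings D. n dvd (\<Sum>a\<in>arcs D. cleared_entry m D c a * X a)) \<longleftrightarrow> X \<in> colourings n m D"
      unfolding colourings_def using X colouring_condition[OF _ X cop] by auto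
    finally show ?thesis .
  qed
  have FG: "F (G x) = x" if "x \<in> {..<N} \<rightarrow>\<^sub>E {0..<n}" for x
    using that by (auto simp: F_def G_def col_mem inv_col PiE_iff extensional_def fun_eq_iff)
  have G: "G x \<in> arcs D \<rightarrow>\<^sub>E {0..<n}" if "x \<in> {..<N} \<rightarrow>\<^sub>E {0..<n}" for x
    unfolding G_def using PiE_mem[OF that] inv_mem by auto
  have "bij_betw F (colourings n m D) (ker_mod n ?M)"
  proof (rule bij_betw_byWitness[where f' = G])
    show "\<forall>X\<in>colourings n m D. G (F X) = X"
      by (auto simp: colourings_def F_def G_def inv_mem col_inv PiE_iff extensional_def fun_eq_iff)
    show "\<forall>x\<in>ker_mod n ?M. F (G x) = x"
      using FG by (simp add: ker_mod_def)
    show "F ` colourings n m D \<subseteq> ker_mod n ?M"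
      using mem by (auto simp: colourings_def)
    show "G ` ker_mod n ?M \<subseteq> colourings n m D"
    proof (rule image_subsetI)
      fix x assume x: "x \<in> ker_mod n ?M"
      then have "x \<in> {..<N} \<rightarrow>\<^sub>E {0..<n}" by (simp add: ker_mod_def)
      then show "G x \<in> colourings n m D" using mem[OF G, of x] FG[of x] x by simp
    qed
  qed
  then show ?thesis by (simp add: num_colourings_def bij_betw_same_card)
qed

lemma eval_colouring_entry:
  assumes "m \<noteq> 0"
  shows "of_int (cleared_entry m D c a) =
    (if positive D c then 1 else of_int m) * eval_at (of_int m) (colouring_entry D c a)"
  using assms
  by (simp add: cleared_entry_def colouring_entry_def Let_def eval_at_add eval_at_diff eval_at_uminus
      power_int_minus field_simps)

end

text \<open>The integer matrix uses the enumerations of the matrix \<open>A\<close> that witnesses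
  \<open>alexander_polynomial\<close>, so both lose the same row and column. The number of
  colourings may be computed with any enumeration.\<close>

lemma num_colourings_eq:
  assumes knot: "knot_diagram D" and alex: "alexander_polynomial D p"
    and n: "n > 0" and cop: "coprime n m" and m: "m > 0"
    and v: "poly (value_poly p) m \<noteq> 0" "poly (value_poly p) m dvd n"
  shows "num_colourings n m D = nat n * nat \<bar>poly (value_poly p) m\<bar>"
proof -
  from knot have wf: "well_formed D"
    and planar: "int (card (crossings D)) - int (card (edges D)) + int (card (regions D)) = 2"
    by (simp_all add: knot_diagram_def)
  interpret diagram D using wf by unfold_locales
  let ?v = "poly (value_poly p) m" and ?x = "of_int m :: rat"
  interpret ev: comm_ring_hom "eval_at ?x" using m by (intro comm_ring_hom_eval_at) simp
  have "card (crossings D) \<noteq> 0" using len_eq len_pos by auto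
  then obtain N where N: "card (crossings D) = Suc N" using not0_implies_Suc by blast
  from alex obtain A s k where A: "colouring_matrix D A" and s: "s \<in> {1, - 1}"
    and p: "p = s * mpow k * det (mat_delete A (dim_row A - 1) (dim_col A - 1))"
    and nonneg: "\<forall>j<0. Poly_Mapping.lookup p j = 0"
    unfolding alexander_polynomial_def by blast
  from A obtain \<rho> \<kappa> where row: "bij_betw \<rho> {..<Suc N} (crossings D)"
    and col: "bij_betw \<kappa> {..<Suc N} (arcs D)"
    and A_eq: "A = mat (Suc N) (Suc N) (\<lambda>(i, k). colouring_entry D (\<rho> i) (\<kappa> k))"
    unfolding colouring_matrix_def Let_def N by blast
  define M where "M = mat (Suc N) (Suc N) (\<lambda>(i, k). cleared_entry m D (\<rho> i) (\<kappa> k))"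
  have M: "M \<in> carrier_mat (Suc N) (Suc N)" by (simp add: M_def)
  have row_mem: "\<rho> i \<in> crossings D" if "i < Suc N" for i using row that bij_betwE by fastforce
  obtain w where w: "\<And>c. c \<in> crossings D \<Longrightarrow> coprime (w c) n"
    "\<And>a. n dvd (\<Sum>c\<in>crossings D. w c * cleared_entry m D c a)"
    using crossing_relation[OF planar n cop] by blast
  let ?M' = "mat_delete M N N" and ?A' = "mat_delete A N N"
  have "card (ker_mod n M) = nat n * card (ker_mod n ?M')"
  proof (rule card_ker_mod_delete_last[OF M n])
    fix i assume i: "i < Suc N"
    have "(\<Sum>k<Suc N. M $$ (i, k)) = (\<Sum>k<Suc N. cleared_entry m D (\<rho> i) (\<kappa> k))"
      using i by (intro sum.cong) (auto simp: M_def)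
    also have "\<dots> = (\<Sum>a\<in>arcs D. cleared_entry m D (\<rho> i) a * 1)"
      using sum.reindex_bij_betw[OF col] by simp
    also have "\<dots> = 0" using sum_cleared_entry[OF row_mem[OF i], of m "\<lambda>_. 1"] by simp
    finally show "(\<Sum>k<Suc N. M $$ (i, k)) = 0" .
  next
    fix k assume k: "k < Suc N"
    have "(\<Sum>i<Suc N. w (\<rho> i) * M $$ (i, k)) = (\<Sum>i<Suc N. w (\<rho> i) * cleared_entry m D (\<rho> i) (\<kappa> k))"
      using k by (intro sum.cong) (auto simp: M_def)
    also have "\<dots> = (\<Sum>c\<in>crossings D. w c * cleared_entry m D c (\<kappa> k))"
      by (rule sum.reindex_bij_betw[OF row])
    finally show "n dvd (\<Sum>i<Suc N. w (\<rho> i) * M $$ (i, k))" using w(2) by simp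
  next
    show "coprime (w (\<rho> N)) n" using w(1) row_mem by simp
  qed
  moreover have "num_colourings n m D = card (ker_mod n M)"
    unfolding M_def by (rule num_colourings_ker_mod[OF row col cop])
  moreover have "card (ker_mod n ?M') = nat \<bar>?v\<bar>"
  proof -
    define d where "d i = (if positive D (\<rho> i) then 1 else m)" for i
    define a where "a = (\<Prod>i<N. d i)"
    have "map_mat of_int ?M' = mat N N (\<lambda>(i, j). of_int (d i) * map_mat (eval_at ?x) ?A' $$ (i, j))"
      using m by (intro eq_matI)
        (auto simp: M_def A_eq d_def mat_delete_def eval_colouring_entry)
    then have "det (map_mat of_int ?M' :: rat mat) = (\<Prod>i<N. of_int (d i)) * det (map_mat (eval_at ?x) ?A')"
      using det_row_scale[of "map_mat (eval_at ?x) ?A'" N "\<lambda>i. of_int (d i)"]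
      by (simp add: A_eq mat_delete_def)
    then have det: "of_int (det ?M') = of_int a * eval_at ?x (det ?A')"
      by (simp add: a_def of_int_hom.hom_det ev.hom_det)
    have "p = s * mpow k * det ?A'" using p by (simp add: A_eq)
    then have "eval_at ?x p = eval_at ?x s * ?x powi k * eval_at ?x (det ?A')"
      by (simp add: ev.hom_mult)
    moreover have "eval_at ?x s = 1 \<or> eval_at ?x s = - 1" using s by (auto simp: eval_at_uminus)
    ultimately have "\<bar>of_int ?v\<bar> = ?x powi k * \<bar>eval_at ?x (det ?A')\<bar>"
      using m by (auto simp: poly_value_poly[OF nonneg] abs_mult)
    moreover have a_pos: "a > 0" unfolding a_def d_def using m by (intro prod_pos) auto
    ultimately have rel: "of_int a * \<bar>of_int ?v\<bar> = ?x powi k * \<bar>of_int (det ?M')\<bar>"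
      unfolding det by (simp add: abs_mult)
    \<comment> \<open>Multiplying by \<open>?x ^ nat (- k)\<close> makes both exponents of m
      natural, whatever the sign of k, so the relation holds over the integers.\<close>
    have rel': "a * m ^ nat (- k) * \<bar>?v\<bar> = m ^ nat k * \<bar>det ?M'\<bar>"
    proof -
      have "?x powi k * ?x ^ nat (- k) = ?x ^ nat k"
        using m by (auto simp: power_int_def power_mult_distrib[symmetric])
      with rel have "of_int a * ?x ^ nat (- k) * \<bar>of_int ?v\<bar> = ?x ^ nat k * \<bar>of_int (det ?M')\<bar>"
        by (metis (no_types, lifting) mult.assoc mult.commute)
      then have "(of_int (a * m ^ nat (- k) * \<bar>?v\<bar>) :: rat) = of_int (m ^ nat k * \<bar>det ?M'\<bar>)"
        by simp
      then show ?thesis by (simp only: of_int_eq_iff)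
    qed
    \<comment> \<open>The power of m on the side of \<open>?v\<close>. It is coprime to n but need
      not divide n, which is why \<open>card_ker_mod\<close> asks only for a divisor of
      \<open>u * n\<close>.\<close>
    define u where "u = a * m ^ nat (- k)"
    have cop_a: "coprime n a"
      unfolding a_def d_def using cop by (intro prod_coprime_right) auto
    have cop_u: "coprime n u" using cop cop_a by (simp add: u_def)
    have u0: "u \<noteq> 0" using a_pos m by (simp add: u_def)
    have "det ?M' dvd m ^ nat k * \<bar>det ?M'\<bar>" by simp
    also have "\<dots> = u * \<bar>?v\<bar>" using rel' by (simp add: u_def)
    also have "\<dots> dvd u * n" using v(2) by (intro mult_dvd_mono) auto
    finally have dvd: "det ?M' dvd u * n" .
    have "?M' \<in> carrier_mat N N" using mat_delete_carrier[OF M, of N N] by simp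
    then have "card (ker_mod n ?M') = nat (gcd (det ?M') n)"
      using card_ker_mod n dvd u0 cop_u by (metis coprime_commute)
    also have "gcd (det ?M') n = gcd (m ^ nat k * \<bar>det ?M'\<bar>) n"
      using cop by (simp add: gcd_mult_left_left_cancel)
    also have "\<dots> = gcd (u * \<bar>?v\<bar>) n" using rel' by (simp add: u_def)
    also have "\<dots> = gcd ?v n" using cop_u by (simp add: gcd_mult_left_left_cancel)
    also have "\<dots> = \<bar>?v\<bar>" using v(2) by (simp add: gcd_proj1_iff)
    finally show ?thesis .
  qed
  ultimately show ?thesis by simp
qed

text \<open>Modulo m the value of the polynomial is its constant coefficient.\<close>

lemma coprime_poly_value:
  fixes q :: "int poly"
  assumes "coprime m (Polynomial.coeff q 0)"
  shows "coprime m (poly q m)"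
proof (cases q)
  case (pCons a r)
  show ?thesis
  proof (rule coprimeI)
    fix c assume c: "c dvd m" "c dvd poly q m"
    then have "c dvd a" using pCons by (simp add: dvd_add_left_iff)
    moreover have "coprime m a" using assms pCons by simp
    ultimately show "is_unit c" using c(1) coprime_common_divisor by blast
  qed
qed

theorem proposition25:
  fixes D\<^sub>1 D\<^sub>2 :: gauss_code and A\<^sub>1 A\<^sub>2 :: "laurent mat" and p\<^sub>1 p\<^sub>2 :: laurent
  assumes "knot_diagram D\<^sub>1" and "knot_diagram D\<^sub>2"
    and "alexander_polynomial D\<^sub>1 p\<^sub>1" and "alexander_polynomial D\<^sub>2 p\<^sub>2" and "p\<^sub>1 \<noteq> p\<^sub>2"
    and "colouring_matrix D\<^sub>1 A\<^sub>1" and "triangularizable A\<^sub>1"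
    and "colouring_matrix D\<^sub>2 A\<^sub>2" and "triangularizable A\<^sub>2"
  shows "\<exists>n m :: int. n \<ge> 1 \<and> coprime n m \<and> num_colourings n m D\<^sub>1 \<noteq> num_colourings n m D\<^sub>2"
proof -
  define q\<^sub>1 q\<^sub>2 where "q\<^sub>1 = value_poly p\<^sub>1" and "q\<^sub>2 = value_poly p\<^sub>2"
  have nonneg: "\<forall>j<0. Poly_Mapping.lookup p\<^sub>1 j = 0" "\<forall>j<0. Poly_Mapping.lookup p\<^sub>2 j = 0"
    using assms(3,4) by (auto simp: alexander_polynomial_def)
  have const: "Polynomial.coeff q\<^sub>1 0 > 0" "Polynomial.coeff q\<^sub>2 0 > 0"
    using assms(3,4) nonneg by (auto simp: alexander_polynomial_def q\<^sub>1_def q\<^sub>2_def coeff_value_poly)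
  have "q\<^sub>1 \<noteq> q\<^sub>2"
    using value_poly_inj[OF nonneg] assms(5) by (auto simp: q\<^sub>1_def q\<^sub>2_def)
  \<comment> \<open>The counts see only absolute values, so opposite values must be avoided too; the
    positive constant terms rule out that the two polynomials are negatives of each other.\<close>
  moreover have "q\<^sub>1 + q\<^sub>2 \<noteq> 0"
    using const by (metis Polynomial.coeff_0 Polynomial.coeff_add add_pos_pos less_irrefl)
  moreover have "q\<^sub>1 \<noteq> 0" "q\<^sub>2 \<noteq> 0" using const by auto
  moreover define r where "r = q\<^sub>1 * q\<^sub>2 * (q\<^sub>1 - q\<^sub>2) * (q\<^sub>1 + q\<^sub>2)"
  ultimately have "r \<noteq> 0" by simp
  then have fin: "finite {m. poly r m = 0}" by (rule poly_roots_finite)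
  define c where "c = Polynomial.coeff q\<^sub>1 0 * Polynomial.coeff q\<^sub>2 0"
  have "c > 0" using const by (simp add: c_def)
  then have "inj (\<lambda>t. 1 + c * int t)" by (auto simp: inj_def)
  then have "\<not> range (\<lambda>t. 1 + c * int t) \<subseteq> {m. poly r m = 0}"
    using finite_subset[OF _ fin] range_inj_infinite by blast
  then obtain m t where m_def: "m = 1 + c * int t" and r: "poly r m \<noteq> 0" by blast
  have m: "m > 0" using \<open>c > 0\<close> by (simp add: m_def add_pos_nonneg)
  let ?v\<^sub>1 = "poly q\<^sub>1 m" and ?v\<^sub>2 = "poly q\<^sub>2 m"
  have v: "?v\<^sub>1 \<noteq> 0" "?v\<^sub>2 \<noteq> 0" "\<bar>?v\<^sub>1\<bar> \<noteq> \<bar>?v\<^sub>2\<bar>"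
    using r by (auto simp: r_def abs_eq_iff)
  have "coprime m c"
    unfolding m_def by (rule coprimeI) (metis dvd_add_left_iff dvd_mult2)
  then have "coprime m ?v\<^sub>1" "coprime m ?v\<^sub>2"
    by (auto simp: c_def intro!: coprime_poly_value)
  define n where "n = \<bar>?v\<^sub>1 * ?v\<^sub>2\<bar>"
  have n: "n > 0" using v by (simp add: n_def)
  have cop: "coprime n m"
    using \<open>coprime m ?v\<^sub>1\<close> \<open>coprime m ?v\<^sub>2\<close> by (simp add: n_def coprime_commute)
  have "num_colourings n m D\<^sub>1 = nat n * nat \<bar>?v\<^sub>1\<bar>"
    using num_colourings_eq[OF assms(1,3) n cop m] v by (simp add: q\<^sub>1_def n_def)
  moreover have "num_colourings n m D\<^sub>2 = nat n * nat \<bar>?v\<^sub>2\<bar>"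
    using num_colourings_eq[OF assms(2,4) n cop m] v by (simp add: q\<^sub>2_def n_def)
  ultimately have "num_colourings n m D\<^sub>1 \<noteq> num_colourings n m D\<^sub>2"
    using n v(3) by (simp add: eq_nat_nat_iff)
  then show ?thesis using n cop by (metis int_one_le_iff_zero_less)
qed

end
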